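(* Assume $\infty$ belongs to the support of $D$, and write $D=\sum_{i=1}^{\nu}n_i[t_i]+n_\infty[\infty]$ with $n_\infty\ge1$, $n=\deg D$, and $P(x)=\prod_{i=1}^{\nu}(x-t_i)^{n_i}$. Let $(E,\nabla)\in\mathcal V$ with apparent divisor $Q=q_1+\dots+q_{n-3}$ (assumed to have all $q_j$ in the affine chart, distinct from each other and from the $t_i$). After applying to $\nabla$ the birational transformation $\phi_\nabla$ and normalizing by an automorphism of $E_0=\mathcal O\oplus\Omega^1(D)\simeq\mathcal O\oplus\mathcal O(n-2)$, one gets the unique normal form $\nabla_0=d+\Omega_0$ with $$\Omega_0=\begin{pmatrix}0&\frac1{P(x)}\\ c_0(x)&d_0(x)\end{pmatrix}dx,$$ and the coefficients take the form $$c_0(x)=\sum_{i=1}^{\nu}\frac{C_i(x)}{(x-t_i)^{n_i}}+\sum_{j=1}^{n-3}\frac{\zeta_j}{x-q_j}+\tilde C(x)+x^{n-3}C_\infty(x),$$ $$d_0(x)=\sum_{i=1}^{\nu}\frac{D_i(x)}{(x-t_i)^{n_i}}+\sum_{j=1}^{n-3}\frac{-1}{x-q_j}+D_\infty(x),$$ where $\zeta_j\in\mathbb C$ and $C_i,D_i,C_\infty,D_\infty,\tilde C$ are polynomials with - $\deg C_i,\deg D_i\le n_i-1$ for $i=1,\ldots,\nu$; - $\deg C_\infty\le n_\infty-1$ and $\deg D_\infty\le n_\infty-2$; - $\deg\tilde C\le n-4$.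
   Context: Everything is over $\mathbb C$. Write $\mathcal O,\mathcal O(k),\Omega^1$ for line bundles on $\mathbb P^1$, and $x$ for an affine coordinate. A polynomial of degree bounded by a negative number is zero. A rank $2$ meromorphic connection $(E,\nabla)$ with polar divisor $D$ is a rank $2$ holomorphic vector bundle $E\to\mathbb P^1$ with a $\mathbb C$-linear $\nabla:E\to E\otimes\Omega^1(D)$ satisfying the Leibniz rule; in a trivialization $\nabla=d+\Omega$. Formal data: $\Lambda_{t}(\nabla)=(\mathrm{tr}(\nabla)^{<0}_{t},\det(\nabla)^{<-m}_{t})$ at a pole $t$ of order $m$, where the first term is the class of $\mathrm{tr}\,\Omega$ in germs of $\Omega^1(D)/\Omega^1$ and the second is the class of $\det\Omega$ in germs of $(\Omega^1(D))^{\otimes2}/(\Omega^1)^{\otimes2}(D)$; $\Lambda$ is a fixed collection of such data at all poles, satisfying the Fuchs relation $\sum\mathrm{Res}\,\mathrm{tr}=-1$, with reduced poles (non-scalar leading coefficients, and at poles of order $m>1$ the discriminant $\mathrm{tr}^2-4\det$ has pole order $2m$ or $2m-1$). A $\Lambda$-connection is a connection with polar divisor $D$, $\deg E=1$ and formal data $\Lambda$. $\mathcal M_{\boldsymbol\mu}^\Lambda$ is the moduli space of $\boldsymbol\mu$-stable parabolic $\Lambda$-connections for convenient weights $\boldsymbol\mu$ (for generic $\Lambda$, simply the moduli space of $\Lambda$-connections; parabolic structure and weights play no role in this statement). $\mathcal U\subset\mathcal M_{\boldsymbol\mu}^\Lambda$: the set of $(E,\nabla)$ with $E\simeq\mathcal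 O\oplus\mathcal O(1)$ and $L=\mathcal O(1)$ not $\nabla$-invariant. For $(E,\nabla)\in\mathcal U$, $\varphi_\nabla$ is the nonzero $\mathcal O$-linear composition $L\hookrightarrow E\xrightarrow{\nabla}E\otimes\Omega^1(D)\to(E/L)\otimes\Omega^1(D)\simeq\Omega^1(D)$, and $Q=\mathrm{App}(E,\nabla)=\mathrm{div}(\varphi_\nabla)\in|\mathcal O(n-3)|$. $\mathcal V\subset\mathcal U$ is the set where $Q$ is reduced with support disjoint from $D$. For $(E,\nabla)\in\mathcal V$, $\phi_\nabla=\mathrm{id}\oplus\varphi_\nabla:\mathcal O\oplus\mathcal O(1)\dashrightarrow E_0=\mathcal O\oplus\Omega^1(D)$. The bundle $\mathcal O\oplus\mathcal O(k)$ is given by two charts with coordinates $(x,Y)\in\mathbb C\times\mathbb C^2$ and $(\tilde x,\tilde Y)$, $x=1/\tilde x$, $Y=\mathrm{diag}(1,x^k)\tilde Y$; here $k=n-2$ and the second coordinate of $Y$ in the affine chart is relative to the generator $dx/P(x)$ of $\Omega^1(D)$. The matrix $\Omega_0$ is the connection matrix in the affine chart. The normalization is by bundle automorphisms of $E_0$, and consists in requiring that the $(1,1)$-coefficient vanish and the $(1,2)$-coefficient be $dx/P(x)$. *)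

theory Defs
  imports "HOL-Complex_Analysis.Complex_Analysis" "HOL-Computational_Algebra.Polynomial"
begin

section \<open>The projective line and divisors\<close>

text \<open>
  \<open>Aff a\<close> is the point \<open>x = a\<close> of the affine chart, \<open>Infty\<close> the point \<open>y = 0\<close> of the chart
  at infinity, where \<open>y = 1/x\<close>.
\<close>

datatype proj_line = Aff complex | Infty

fun coord :: "proj_line \<Rightarrow> complex" where
  "coord (Aff a) = a"
| "coord Infty = 0"

type_synonym divisor = "proj_line \<Rightarrow> int"

definition pt :: "proj_line \<Rightarrow> divisor" where
  "pt p = (\<lambda>r. if r = p then 1 else 0)"

definition div_support :: "divisor \<Rightarrow> proj_line set" where
  "div_support D = {p. D p \<noteq> 0}"

definition div_degree :: "divisor \<Rightarrow> int" where
  "div_degree D = (\<Sum>p\<in>div_support D. D p)"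

text \<open>The monic polynomial cutting out the affine part of an effective divisor.\<close>

definition div_poly :: "divisor \<Rightarrow> complex \<Rightarrow> complex" where
  "div_poly D x = (\<Prod>a | Aff a \<in> div_support D. (x - a) ^ nat (D (Aff a)))"

definition pole_order_le :: "(complex \<Rightarrow> complex) \<Rightarrow> complex \<Rightarrow> int \<Rightarrow> bool" where
  "pole_order_le f a k \<longleftrightarrow>
     (\<exists>g. g analytic_on {a} \<and> (\<forall>\<^sub>F z in at a. f z = g z * (z - a) powi (- k)))"


section \<open>Rank 2 bundles\<close>

type_synonym cmat = "complex^2^2"
type_synonym matfun = "complex \<Rightarrow> cmat"

text \<open>
  Every holomorphic vector bundle on the projective line is trivial on each of the two charts
  \<open>x\<close> and \<open>y = 1/x\<close>, so it is given by a cocycle \<open>G\<close>, holomorphic and invertible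
  on the overlap: the fibre coordinates \<open>Y\<close> (affine chart) and \<open>Y'\<close> (chart at infinity)
  are related by \<open>Y = G(x) Y'\<close>.
\<close>

definition mat_holomorphic_on :: "matfun \<Rightarrow> complex set \<Rightarrow> bool" where
  "mat_holomorphic_on M S \<longleftrightarrow> (\<forall>i j. (\<lambda>z. M z $ i $ j) holomorphic_on S)"

definition holomorphic_bundle :: "matfun \<Rightarrow> bool" where
  "holomorphic_bundle G \<longleftrightarrow> mat_holomorphic_on G (- {0}) \<and> (\<forall>x. x \<noteq> 0 \<longrightarrow> det (G x) \<noteq> 0)"

text \<open>With this convention the cocycle \<open>x^k\<close> defines \<open>O(k)\<close>.\<close>

definition bundle_degree :: "matfun \<Rightarrow> complex" where
  "bundle_degree G = winding_number ((\<lambda>x. det (G x)) \<circ> circlepath 0 1) 0"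

definition diag2 :: "complex \<Rightarrow> complex \<Rightarrow> cmat" where
  "diag2 a b = vector [vector [a, 0], vector [0, b]]"

text \<open>The cocycle of \<open>O \<oplus> O(k)\<close>.\<close>

definition split_bundle :: "int \<Rightarrow> matfun" where
  "split_bundle k = (\<lambda>x. diag2 1 (x powi k))"

text \<open>
  A (bimeromorphic) bundle transformation is the pair of its matrices in the affine chart and
  in the chart at infinity (the latter as a function of \<open>y\<close>), acting on fibre coordinates.
\<close>

type_synonym transf = "matfun \<times> matfun"

definition bundle_iso :: "matfun \<Rightarrow> matfun \<Rightarrow> transf \<Rightarrow> bool" where
  "bundle_iso G H \<sigma> \<longleftrightarrow>
     mat_holomorphic_on (fst \<sigma>) UNIV \<and> (\<forall>x. det (fst \<sigma> x) \<noteq> 0) \<and>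
     mat_holomorphic_on (snd \<sigma>) UNIV \<and> (\<forall>y. det (snd \<sigma> y) \<noteq> 0) \<and>
     (\<forall>x. x \<noteq> 0 \<longrightarrow> fst \<sigma> x ** G x = H x ** snd \<sigma> (1 / x))"


section \<open>Meromorphic connections\<close>

text \<open>
  A connection is \<open>d + W(x) dx\<close> in the affine chart and \<open>d + W'(y) dy\<close> in the chart at
  infinity; \<open>form_aff\<close> and \<open>form_inf\<close> are the coefficient matrices \<open>W\<close> and \<open>W'\<close>.
  Their values at the poles carry no meaning.
\<close>

record connection =
  cocycle :: matfun
  form_aff :: matfun
  form_inf :: matfun

definition local_form :: "connection \<Rightarrow> proj_line \<Rightarrow> matfun" where
  "local_form N p = (case p of Aff a \<Rightarrow> form_aff N | Infty \<Rightarrow> form_inf N)"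

definition mat_deriv :: "matfun \<Rightarrow> matfun" where
  "mat_deriv M x = (\<chi> i j. deriv (\<lambda>z. M z $ i $ j) x)"

text \<open>
  The matrix of \<open>d + W dx\<close> in the new fibre coordinate \<open>M Y\<close>, where \<open>M\<close> is invertible.
\<close>

definition gauge :: "matfun \<Rightarrow> matfun \<Rightarrow> matfun" where
  "gauge M W x = M x ** W x ** matrix_inv (M x) - mat_deriv M x ** matrix_inv (M x)"

definition scale_mat :: "complex \<Rightarrow> cmat \<Rightarrow> cmat" where
  "scale_mat c A = (\<chi> i j. c * A $ i $ j)"

text \<open>
  A section of \<open>End(E) \<otimes> \<Omega>\<^sup>1(D)\<close> has poles bounded by \<open>D\<close>. In the compatibility
  condition the factor \<open>- 1/x^2\<close> comes from \<open>dy = - dx/x^2\<close>.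
\<close>

definition meromorphic_connection :: "divisor \<Rightarrow> connection \<Rightarrow> bool" where
  "meromorphic_connection D N \<longleftrightarrow>
     holomorphic_bundle (cocycle N) \<and>
     (\<forall>p i j. pole_order_le (\<lambda>z. local_form N p z $ i $ j) (coord p) (D p)) \<and>
     (\<forall>p i j. p \<notin> div_support D \<longrightarrow> (\<lambda>z. local_form N p z $ i $ j) analytic_on {coord p}) \<and>
     (\<forall>x. x \<noteq> 0 \<and> Aff x \<notin> div_support D \<longrightarrow>
        form_aff N x =
        gauge (cocycle N) (\<lambda>x. scale_mat (- 1 / x ^ 2) (form_inf N (1 / x))) x)"

definition push :: "transf \<Rightarrow> matfun \<Rightarrow> connection \<Rightarrow> connection" where
  "push \<sigma> H N =
     \<lparr>cocycle = H, form_aff = gauge (fst \<sigma>) (form_aff N), form_inf = gauge (snd \<sigma>) (form_inf N)\<rparr>"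


section \<open>Formal data\<close>

text \<open>
  At each pole \<open>p\<close>, the classes modulo \<open>\<Omega>\<^sup>1\<close> and modulo \<open>(\<Omega>\<^sup>1)\<^sup>\<otimes>\<^sup>2(D)\<close> are given by
  representatives \<open>data_tr \<Lambda> p\<close> and \<open>data_det \<Lambda> p\<close>, the coefficients of \<open>dz\<close> and
  \<open>dz \<otimes> dz\<close> for \<open>z = x\<close> at an affine point and \<open>z = y\<close> at infinity. For \<open>D p > 1\<close> the
  condition on the discriminant depends only on the classes.
\<close>

record formal_data =
  data_tr :: "proj_line \<Rightarrow> complex \<Rightarrow> complex"
  data_det :: "proj_line \<Rightarrow> complex \<Rightarrow> complex"

definition data_disc :: "formal_data \<Rightarrow> proj_line \<Rightarrow> complex \<Rightarrow> complex" where
  "data_disc \<Lambda> p z = (data_tr \<Lambda> p z)^2 - 4 * data_det \<Lambda> p z"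

definition admissible_data :: "divisor \<Rightarrow> formal_data \<Rightarrow> bool" where
  "admissible_data D \<Lambda> \<longleftrightarrow>
     (\<forall>p\<in>div_support D.
        pole_order_le (data_tr \<Lambda> p) (coord p) (D p) \<and>
        pole_order_le (data_det \<Lambda> p) (coord p) (2 * D p)) \<and>
     (\<Sum>p\<in>div_support D. residue (data_tr \<Lambda> p) (coord p)) = - 1 \<and>
     (\<forall>p. 1 < D p \<longrightarrow>
        is_pole (data_disc \<Lambda> p) (coord p) \<and>
        - zorder (data_disc \<Lambda> p) (coord p) \<in> {2 * D p, 2 * D p - 1})"

definition has_formal_data :: "divisor \<Rightarrow> formal_data \<Rightarrow> connection \<Rightarrow> bool" where
  "has_formal_data D \<Lambda> N \<longleftrightarrow>
     (\<forall>p\<in>div_support D.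
        pole_order_le (\<lambda>z. trace (local_form N p z) - data_tr \<Lambda> p z) (coord p) 0 \<and>
        pole_order_le (\<lambda>z. det (local_form N p z) - data_det \<Lambda> p z) (coord p) (D p))"

definition nonscalar_leading_coeff :: "divisor \<Rightarrow> connection \<Rightarrow> proj_line \<Rightarrow> bool" where
  "nonscalar_leading_coeff D N p \<longleftrightarrow>
     (\<exists>A. ((\<lambda>z. scale_mat ((z - coord p) powi D p) (local_form N p z)) \<longlongrightarrow> A) (at (coord p)) \<and>
          (\<forall>c. A \<noteq> mat c))"

definition \<Lambda>_connection :: "divisor \<Rightarrow> formal_data \<Rightarrow> connection \<Rightarrow> bool" where
  "\<Lambda>_connection D \<Lambda> N \<longleftrightarrow>
     meromorphic_connection D N \<and> bundle_degree (cocycle N) = 1 \<and> has_formal_data D \<Lambda> N \<and>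
     (\<forall>p\<in>div_support D. nonscalar_leading_coeff D N p)"


section \<open>The map \<open>\<phi>\<close> and the apparent divisor\<close>

text \<open>
  A splitting is an isomorphism onto \<open>O \<oplus> O(1)\<close>. After transport by a splitting, \<open>L = O(1)\<close>
  is spanned by the second basis vector, \<open>E/L\<close> is read off by the first coordinate, and the
  composition \<open>L \<rightarrow> E \<rightarrow> E \<otimes> \<Omega>\<^sup>1(D) \<rightarrow> (E/L) \<otimes> \<Omega>\<^sup>1(D)\<close> is the \<open>(1,2)\<close> entry of the
  connection matrix. \<open>L\<close>, being the unique subbundle isomorphic to \<open>O(1)\<close>, does not
  depend on the splitting.
\<close>

definition is_splitting :: "connection \<Rightarrow> transf \<Rightarrow> bool" where
  "is_splitting N \<sigma> \<longleftrightarrow> bundle_iso (cocycle N) (split_bundle 1) \<sigma>"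

definition split_conn :: "transf \<Rightarrow> connection \<Rightarrow> connection" where
  "split_conn \<sigma> N = push \<sigma> (split_bundle 1) N"

definition L_invariant :: "divisor \<Rightarrow> connection \<Rightarrow> bool" where
  "L_invariant D T \<longleftrightarrow> (\<forall>x. Aff x \<notin> div_support D \<longrightarrow> form_aff T x $ 1 $ 2 = 0)"

definition set_U :: "divisor \<Rightarrow> formal_data \<Rightarrow> connection set" where
  "set_U D \<Lambda> =
     {N. \<Lambda>_connection D \<Lambda> N \<and> (\<exists>\<sigma>. is_splitting N \<sigma> \<and> \<not> L_invariant D (split_conn \<sigma> N))}"

text \<open>
  The order of vanishing at \<open>p\<close> as a section of \<open>Hom(L, (E/L) \<otimes> \<Omega>\<^sup>1(D))\<close>. Another
  splitting changes the \<open>(1,2)\<close> entry by a nowhere vanishing factor, so the choice is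
  immaterial.
\<close>

definition App :: "divisor \<Rightarrow> connection \<Rightarrow> divisor" where
  "App D N p =
     (let T = split_conn (SOME \<sigma>. is_splitting N \<sigma>) N
      in zorder (\<lambda>z. local_form T p z $ 1 $ 2) (coord p) + D p)"

definition set_V :: "divisor \<Rightarrow> formal_data \<Rightarrow> connection set" where
  "set_V D \<Lambda> =
     {N \<in> set_U D \<Lambda>. (\<forall>p. App D N p \<le> 1) \<and> div_support (App D N) \<inter> div_support D = {}}"

text \<open>
  The transformation \<open>id \<oplus> \<phi>\<close> from \<open>O \<oplus> O(1)\<close> to \<open>O \<oplus> \<Omega>\<^sup>1(D) = O \<oplus> O(n-2)\<close>,
  \<open>n = deg D\<close>. With \<open>P = div_poly D\<close>, the generator of \<open>\<Omega>\<^sup>1(D)\<close> is \<open>dx/P(x)\<close> in the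
  affine chart, and \<open>x^(n-2) dx/P(x) = - dy/(y^n P(1/y))\<close> at infinity.
\<close>

definition phi_transf :: "divisor \<Rightarrow> connection \<Rightarrow> transf" where
  "phi_transf D T =
     (\<lambda>x. diag2 1 (div_poly D x * form_aff T x $ 1 $ 2),
      \<lambda>y. diag2 1 (- (y powi div_degree D) * div_poly D (1 / y) * form_inf T y $ 1 $ 2))"

definition E0_bundle :: "divisor \<Rightarrow> matfun" where
  "E0_bundle D = split_bundle (div_degree D - 2)"

text \<open>
  The connection on \<open>E\<^sub>0\<close> obtained by applying \<open>id \<oplus> \<phi>\<close> (relative to the splitting \<open>\<sigma>\<close>)
  and then the automorphism \<open>\<psi>\<close> of \<open>E\<^sub>0\<close>.
\<close>

definition E0_connection :: "divisor \<Rightarrow> transf \<Rightarrow> transf \<Rightarrow> connection \<Rightarrow> connection" where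
  "E0_connection D \<sigma> \<psi> N =
     (let T = split_conn \<sigma> N
      in push \<psi> (E0_bundle D) (push (phi_transf D T) (E0_bundle D) T))"

definition normal_matrix ::
    "(complex \<Rightarrow> complex) \<Rightarrow> (complex \<Rightarrow> complex) \<Rightarrow> (complex \<Rightarrow> complex) \<Rightarrow> matfun" where
  "normal_matrix P c d x = vector [vector [0, 1 / P x], vector [c x, d x]]"

text \<open>Degree bound with an integer bound; a negative bound forces the zero polynomial.\<close>

definition deg_le :: "complex poly \<Rightarrow> int \<Rightarrow> bool" where
  "deg_le p k \<longleftrightarrow> p = 0 \<or> int (degree p) \<le> k"

end

theory Submission
  imports Defs "HOL-Computational_Algebra.Fundamental_Theorem_Algebra"
begin

text \<open>
  After a splitting of the bundle as \<open>O \<oplus> O(1)\<close>, the connection matrix in the affine chart is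
  \<open>(A, B; C, E)/P\<close> with polynomials \<open>A, B, C, E\<close> of degrees at most \<open>n - 2, n - 3, n - 1, n - 2\<close>:
  clear the denominators, read the growth at infinity in the other chart and apply Liouville's
  theorem (\<open>split_bundle_connection_rational\<close>). The map \<open>\<phi>\<close> is multiplication by \<open>B\<close>. The
  apparent divisor is therefore the divisor of zeros of \<open>B\<close> (\<open>App_eq_order\<close>), so \<open>B\<close> is a
  constant times the product of the \<open>x - q j\<close>, and \<open>n \<ge> 3\<close> because \<open>B \<noteq> 0\<close>.

  Applying \<open>id \<oplus> \<phi>\<close> and then the automorphism \<open>(1, 0; A, 1)\<close> of \<open>O \<oplus> O(n - 2)\<close> produces the
  first row \<open>(0, 1/P)\<close> and
  \<open>c\<^sub>0 = (B C - A E)/P + A B'/B - A'\<close>, \<open>d\<^sub>0 = (A + E)/P - B'/B\<close>.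
  Uniqueness has two parts. For a given splitting, an automorphism of \<open>E\<^sub>0\<close> is lower triangular
  with constant diagonal, and the prescribed first row determines it up to a scalar
  (\<open>E0_connection_normal_form_unique\<close>). Two splittings differ by an automorphism of
  \<open>O \<oplus> O(1)\<close>, under which the two expressions above are invariant (\<open>rational_form_change\<close>).

  Since \<open>B'/B\<close> is the sum of the \<open>1/(x - q j)\<close>, the shape of \<open>c\<^sub>0\<close> and \<open>d\<^sub>0\<close> is a partial fraction
  expansion, in which the degree bounds on \<open>A, B, C, E\<close> bound the polynomial part; in
  particular \<open>\<zeta> j = A (q j)\<close>.
\<close>

\<comment> \<open>The symbol \<open>$\<close> denotes components of vectors here; with its second reading, as coefficients of
  power series, matrix entries parse ambiguously and slowly.\<close>
no_notation fps_nth (infixl "$" 75)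

section \<open>Two by two matrices\<close>

definition mat2 :: "complex \<Rightarrow> complex \<Rightarrow> complex \<Rightarrow> complex \<Rightarrow> cmat" where
  "mat2 a b c d = vector [vector [a, b], vector [c, d]]"

lemma mat2_nth [simp]:
  "mat2 a b c d $ 1 $ 1 = a" "mat2 a b c d $ 1 $ 2 = b"
  "mat2 a b c d $ 2 $ 1 = c" "mat2 a b c d $ 2 $ 2 = d"
  by (simp_all add: mat2_def)

lemma cmat_eq_iff:
  fixes A B :: cmat
  shows "A = B \<longleftrightarrow> A $ 1 $ 1 = B $ 1 $ 1 \<and> A $ 1 $ 2 = B $ 1 $ 2 \<and> A $ 2 $ 1 = B $ 2 $ 1 \<and> A $ 2 $ 2 = B $ 2 $ 2"
  by (auto simp: vec_eq_iff forall_2)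

lemma mat2_eta: "mat2 (A $ 1 $ 1) (A $ 1 $ 2) (A $ 2 $ 1) (A $ 2 $ 2) = A"
  by (simp add: cmat_eq_iff)

lemma det_mat2 [simp]: "det (mat2 a b c d) = a * d - b * c"
  by (simp add: det_2)

lemma mat2_mult: "mat2 a b c d ** mat2 a' b' c' d' =
    mat2 (a * a' + b * c') (a * b' + b * d') (c * a' + d * c') (c * b' + d * d')"
  by (simp add: cmat_eq_iff matrix_matrix_mult_def sum_2)

lemma mat2_diff: "mat2 a b c d - mat2 a' b' c' d' = mat2 (a - a') (b - b') (c - c') (d - d')"
  by (simp add: cmat_eq_iff)

lemma diag2_eq_mat2: "diag2 a b = mat2 a 0 0 b"
  by (simp add: diag2_def mat2_def)

lemma mat_1_eq_mat2: "(mat 1 :: cmat) = mat2 1 0 0 1"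
  by (simp add: cmat_eq_iff mat_def)

lemma matrix_inv_eqI:
  fixes A B :: cmat
  assumes "A ** B = mat 1" "B ** A = mat 1"
  shows "matrix_inv A = B"
proof -
  have "\<exists>A'. A ** A' = mat 1 \<and> A' ** A = mat 1" using assms by blast
  then have "A ** matrix_inv A = mat 1 \<and> matrix_inv A ** A = mat 1"
    unfolding matrix_inv_def by (rule someI_ex)
  then have "matrix_inv A = matrix_inv A ** (A ** B)" "matrix_inv A ** A = mat 1"
    using assms by simp_all
  then show ?thesis by (simp add: matrix_mul_assoc)
qed

lemma matrix_inv_mat2:
  assumes "a * d - b * c \<noteq> 0"
  defines "e \<equiv> a * d - b * c"
  shows "matrix_inv (mat2 a b c d) = mat2 (d / e) (- b / e) (- c / e) (a / e)"
proof (rule matrix_inv_eqI)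
  have e: "e \<noteq> 0" "e = a * d - b * c" using assms by auto
  show "mat2 a b c d ** mat2 (d / e) (- b / e) (- c / e) (a / e) = mat 1"
    using e(1) by (simp add: mat2_mult mat_1_eq_mat2 field_simps cmat_eq_iff) (simp add: e(2) algebra_simps)
  show "mat2 (d / e) (- b / e) (- c / e) (a / e) ** mat2 a b c d = mat 1"
    using e(1) by (simp add: mat2_mult mat_1_eq_mat2 field_simps cmat_eq_iff) (simp add: e(2) algebra_simps)
qed

lemma matrix_inv_cmat:
  fixes A :: cmat
  assumes "det A \<noteq> 0"
  shows "matrix_inv A =
    mat2 (A $ 2 $ 2 / det A) (- A $ 1 $ 2 / det A) (- A $ 2 $ 1 / det A) (A $ 1 $ 1 / det A)"
  using matrix_inv_mat2[of "A $ 1 $ 1" "A $ 2 $ 2" "A $ 1 $ 2" "A $ 2 $ 1"] assms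
  by (simp add: mat2_eta det_2)

lemma matrix_inv_left_right:
  fixes A :: cmat
  assumes "det A \<noteq> 0"
  shows "matrix_inv A ** A = mat 1" "A ** matrix_inv A = mat 1"
proof -
  have "\<exists>A'. A ** A' = mat 1 \<and> A' ** A = mat 1"
    using assms invertible_det_nz[of A] by (auto simp: invertible_def)
  then have "A ** matrix_inv A = mat 1 \<and> matrix_inv A ** A = mat 1"
    unfolding matrix_inv_def by (rule someI_ex)
  then show "matrix_inv A ** A = mat 1" "A ** matrix_inv A = mat 1" by auto
qed

lemma det_matrix_inv_nonzero:
  fixes A :: cmat
  assumes "det A \<noteq> 0"
  shows "det (matrix_inv A) \<noteq> 0"
proof
  assume "det (matrix_inv A) = 0"
  then have "det (matrix_inv A ** A) = 0" by (simp add: det_mul)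
  then show False by (simp add: matrix_inv_left_right assms)
qed

lemma cmat_mult_distribs:
  fixes A B C :: cmat
  shows "A ** (B - C) = A ** B - A ** C" "(B - C) ** A = B ** A - C ** A"
    "(B + C) ** A = B ** A + C ** A"
  by (simp_all add: cmat_eq_iff matrix_matrix_mult_def sum_2 algebra_simps)

lemma scale_mat_distribs:
  "A ** scale_mat c B = scale_mat c (A ** B)" "scale_mat c B ** A = scale_mat c (B ** A)"
  "scale_mat c (A - B) = scale_mat c A - scale_mat c B"
  by (simp_all add: cmat_eq_iff scale_mat_def matrix_matrix_mult_def sum_2 algebra_simps)

section \<open>Gauge transformations\<close>

definition mat_differentiable :: "matfun \<Rightarrow> complex \<Rightarrow> bool" where
  "mat_differentiable M x \<longleftrightarrow> (\<forall>i j. (\<lambda>z. M z $ i $ j) field_differentiable at x)"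

lemma mat_holomorphic_on_imp_differentiable:
  "mat_holomorphic_on M S \<Longrightarrow> open S \<Longrightarrow> x \<in> S \<Longrightarrow> mat_differentiable M x"
  unfolding mat_holomorphic_on_def mat_differentiable_def
  by (meson holomorphic_on_imp_differentiable_at)

lemma mat_deriv_mult:
  assumes "mat_differentiable M x" "mat_differentiable K x"
  shows "mat_deriv (\<lambda>z. M z ** K z) x = mat_deriv M x ** K x + M x ** mat_deriv K x"
proof -
  have "((\<lambda>z. M z $ i $ k * K z $ k $ j) has_field_derivative
      (M x $ i $ k * deriv (\<lambda>z. K z $ k $ j) x + deriv (\<lambda>z. M z $ i $ k) x * K x $ k $ j)) (at x)" for i j k
    using assms unfolding mat_differentiable_def
    by (intro DERIV_mult') (simp_all add: DERIV_deriv_iff_field_differentiable)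
  then have D: "((\<lambda>z. M z $ i $ 1 * K z $ 1 $ j + M z $ i $ 2 * K z $ 2 $ j) has_field_derivative
      ((M x $ i $ 1 * deriv (\<lambda>z. K z $ 1 $ j) x + deriv (\<lambda>z. M z $ i $ 1) x * K x $ 1 $ j)
      + (M x $ i $ 2 * deriv (\<lambda>z. K z $ 2 $ j) x + deriv (\<lambda>z. M z $ i $ 2) x * K x $ 2 $ j))) (at x)" for i j
    by (intro DERIV_add)
  have "deriv (\<lambda>z. (M z ** K z) $ i $ j) x =
      (mat_deriv M x ** K x + M x ** mat_deriv K x) $ i $ j" for i j
    using DERIV_imp_deriv[OF D[of i j]] by (simp add: mat_deriv_def matrix_matrix_mult_def sum_2)
  then show ?thesis by (simp add: vec_eq_iff mat_deriv_def)
qed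

lemma gauge_cong:
  assumes "eventually (\<lambda>z. M z = M' z) (nhds x)" "W x = W' x"
  shows "gauge M W x = gauge M' W' x"
proof -
  have "M x = M' x" using assms(1) by (rule eventually_nhds_x_imp_x)
  moreover have "deriv (\<lambda>z. M z $ i $ j) x = deriv (\<lambda>z. M' z $ i $ j) x" for i j
    using assms(1) by (intro deriv_cong_ev) (auto elim: eventually_mono)
  ultimately show ?thesis using assms(2) by (simp add: gauge_def mat_deriv_def)
qed

text \<open>
  Gauge transformations compose, because \<open>(MK)' (MK)\<^sup>-\<^sup>1 = M' M\<^sup>-\<^sup>1 + M (K' K\<^sup>-\<^sup>1) M\<^sup>-\<^sup>1\<close>.
  \<open>W\<close> enters only through its value at \<open>x\<close>, so its values at the poles do not matter.
\<close>

lemma gauge_mult: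
  assumes "mat_differentiable M x" "mat_differentiable K x" "det (M x) \<noteq> 0" "det (K x) \<noteq> 0"
  shows "gauge (\<lambda>z. M z ** K z) W x = gauge M (gauge K W) x"
proof -
  note inv = matrix_inv_left_right[OF assms(3)] matrix_inv_left_right[OF assms(4)]
  let ?Mi = "matrix_inv (M x)" and ?Ki = "matrix_inv (K x)"
  have 1: "matrix_inv (M x ** K x) = ?Ki ** ?Mi"
  proof (rule matrix_inv_eqI)
    have "M x ** K x ** (?Ki ** ?Mi) = M x ** (K x ** ?Ki) ** ?Mi" by (simp only: matrix_mul_assoc)
    then show "M x ** K x ** (?Ki ** ?Mi) = mat 1" by (simp add: inv)
    have "?Ki ** ?Mi ** (M x ** K x) = ?Ki ** (?Mi ** M x) ** K x" by (simp only: matrix_mul_assoc)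
    then show "?Ki ** ?Mi ** (M x ** K x) = mat 1" by (simp add: inv)
  qed
  have 2: "mat_deriv M x ** K x ** (?Ki ** ?Mi) = mat_deriv M x ** ?Mi"
  proof -
    have "mat_deriv M x ** K x ** (?Ki ** ?Mi) = mat_deriv M x ** (K x ** ?Ki) ** ?Mi"
      by (simp only: matrix_mul_assoc)
    then show ?thesis by (simp add: inv)
  qed
  show ?thesis
    unfolding gauge_def mat_deriv_mult[OF assms(1,2)] 1 cmat_mult_distribs 2
    by simp (simp add: matrix_mul_assoc)
qed

text \<open>
  Every transformation that has to be computed below is lower triangular: the cocycle of a split
  bundle, the map \<open>id \<oplus> \<phi>\<close>, the automorphisms of \<open>O \<oplus> O(k)\<close> with \<open>k > 0\<close>, and hence the
  change from one splitting to another. This formula serves all of them.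
\<close>

lemma gauge_lower_triangular:
  assumes M: "\<forall>\<^sub>F z in nhds x. M z = mat2 (u z) 0 (g z) (v z)"
    and du: "(u has_field_derivative u') (at x)" and dg: "(g has_field_derivative g') (at x)"
    and dv: "(v has_field_derivative v') (at x)"
    and nz: "u x \<noteq> 0" "v x \<noteq> 0" and W: "W x = mat2 a b c d"
  shows "gauge M W x = mat2
     (a - b * g x / v x - u' / u x) (u x * b / v x)
     ((g x * a + v x * c) / u x - (g x * b + v x * d) * g x / (u x * v x) - g' / u x + v' * g x / (u x * v x))
     (g x * b / v x + d - v' / v x)"
proof -
  have "gauge M W x = gauge (\<lambda>z. mat2 (u z) 0 (g z) (v z)) W x"
    using M by (rule gauge_cong) simp
  also have "\<dots> = mat2
     (a - b * g x / v x - u' / u x) (u x * b / v x)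
     ((g x * a + v x * c) / u x - (g x * b + v x * d) * g x / (u x * v x) - g' / u x + v' * g x / (u x * v x))
     (g x * b / v x + d - v' / v x)"
  proof -
    have "mat_deriv (\<lambda>z. mat2 (u z) 0 (g z) (v z)) x = mat2 u' 0 g' v'"
      using DERIV_imp_deriv[OF du] DERIV_imp_deriv[OF dg] DERIV_imp_deriv[OF dv]
      by (simp add: cmat_eq_iff mat_deriv_def)
    then show ?thesis
      using nz by (simp add: gauge_def W matrix_inv_mat2 mat2_mult mat2_diff) (simp add: cmat_eq_iff field_simps)
  qed
  finally show ?thesis .
qed

lemma mat_deriv_inverse_arg:
  assumes "mat_differentiable M (1 / x)" "x \<noteq> 0"
  shows "mat_deriv (\<lambda>z. M (1 / z)) x = scale_mat (- 1 / x ^ 2) (mat_deriv M (1 / x))"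
proof -
  have "deriv (\<lambda>z. M (1 / z) $ i $ j) x = - 1 / x ^ 2 * deriv (\<lambda>z. M z $ i $ j) (1 / x)" for i j
  proof -
    have "((\<lambda>z. M z $ i $ j) has_field_derivative deriv (\<lambda>z. M z $ i $ j) (1 / x)) (at (1 / x))"
      using assms(1) by (simp add: mat_differentiable_def DERIV_deriv_iff_field_differentiable)
    moreover have "((\<lambda>z. 1 / z) has_field_derivative - 1 / x ^ 2) (at x)"
      using assms(2) by (auto intro!: derivative_eq_intros simp: power2_eq_square)
    ultimately have "((\<lambda>z. M (1 / z) $ i $ j) has_field_derivative
        deriv (\<lambda>z. M z $ i $ j) (1 / x) * (- 1 / x ^ 2)) (at x)"
      using DERIV_chain2 by fastforce
    then show ?thesis by (simp add: DERIV_imp_deriv)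
  qed
  then show ?thesis by (simp add: cmat_eq_iff mat_deriv_def scale_mat_def)
qed

text \<open>
  Pulling back along \<open>y = 1/x\<close> commutes with gauge transformations; the factor \<open>- 1/x^2\<close> is
  \<open>dy/dx\<close>, and it also appears in the derivative of \<open>M (1/x)\<close>.
\<close>

lemma gauge_inverse_arg:
  assumes "mat_differentiable M (1 / x)" "x \<noteq> 0"
  shows "gauge (\<lambda>z. M (1 / z)) (\<lambda>z. scale_mat (- 1 / z ^ 2) (W (1 / z))) x =
    scale_mat (- 1 / x ^ 2) (gauge M W (1 / x))"
  by (simp add: gauge_def mat_deriv_inverse_arg[OF assms] scale_mat_distribs)

section \<open>Degree bounds\<close>

lemma deg_le_iff_coeff: "deg_le p k \<longleftrightarrow> (\<forall>i. k < int i \<longrightarrow> coeff p i = 0)"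
proof
  assume "deg_le p k"
  then show "\<forall>i. k < int i \<longrightarrow> coeff p i = 0"
    unfolding deg_le_def by (auto intro: coeff_eq_0)
next
  assume *: "\<forall>i. k < int i \<longrightarrow> coeff p i = 0"
  show "deg_le p k"
    unfolding deg_le_def
  proof (rule disjCI)
    assume "\<not> int (degree p) \<le> k"
    then have "lead_coeff p = 0" using * by simp
    then show "p = 0" by simp
  qed
qed

lemma deg_le_0 [simp]: "deg_le 0 k"
  by (simp add: deg_le_def)

lemma deg_le_mono: "deg_le p j \<Longrightarrow> j \<le> k \<Longrightarrow> deg_le p k"
  by (auto simp: deg_le_def)

lemma deg_le_add: "deg_le p k \<Longrightarrow> deg_le q k \<Longrightarrow> deg_le (p + q) k"
  by (simp add: deg_le_iff_coeff)

lemma deg_le_diff: "deg_le p k \<Longrightarrow> deg_le q k \<Longrightarrow> deg_le (p - q) k"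
  by (simp add: deg_le_iff_coeff)

lemma deg_le_sum: "(\<And>i. i \<in> I \<Longrightarrow> deg_le (p i) k) \<Longrightarrow> deg_le (\<Sum>i\<in>I. p i) k"
  by (simp add: deg_le_iff_coeff coeff_sum)

lemma deg_le_mult: "deg_le p j \<Longrightarrow> deg_le q k \<Longrightarrow> deg_le (p * q) (j + k)"
  unfolding deg_le_def using degree_mult_le[of p q] by auto

lemma deg_le_pderiv: "deg_le p k \<Longrightarrow> deg_le (pderiv p) (k - 1)"
  by (simp add: deg_le_iff_coeff coeff_pderiv)

lemma deg_le_zero_const: "deg_le p 0 \<Longrightarrow> poly p x = poly p 0"
  by (auto simp: deg_le_def elim: degree_eq_zeroE)

text \<open>
  The part of degree at least \<open>N\<close> is divisible by \<open>x^N\<close>. For \<open>N = 0\<close> the bound \<open>- 1\<close> forces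
  \<open>r = 0\<close>.
\<close>

lemma deg_le_split:
  assumes "deg_le p k"
  obtains r s where "deg_le r (int N - 1)" "deg_le s (k - int N)" "p = r + monom 1 N * s"
proof
  show "deg_le (poly_cutoff N p) (int N - 1)"
    by (simp add: deg_le_iff_coeff coeff_poly_cutoff)
  show "deg_le (poly_shift N p) (k - int N)"
    using assms by (simp add: deg_le_iff_coeff coeff_poly_shift)
  show "p = poly_cutoff N p + monom 1 N * poly_shift N p"
    by (rule poly_eqI) (simp add: coeff_poly_cutoff coeff_monom_mult coeff_poly_shift)
qed

section \<open>Partial fractions\<close>

text \<open>
  \<open>R\<close> is the Taylor polynomial of degree below \<open>k\<close> of \<open>F/G\<close> at \<open>a\<close>. It is built one coefficient at a
  time, the next one being the value at \<open>a\<close> of the remainder \<open>H/G\<close>.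
\<close>

lemma approximate_quotient_at_point:
  fixes F G :: "complex poly"
  assumes "poly G a \<noteq> 0"
  shows "\<exists>R H. F = R * G + [:- a, 1:] ^ k * H \<and> deg_le R (int k - 1)"
proof (induction k)
  case 0
  have "F = 0 * G + [:- a, 1:] ^ 0 * F \<and> deg_le 0 (int 0 - 1)" by simp
  then show ?case by blast
next
  case (Suc k)
  then obtain R H where RH: "F = R * G + [:- a, 1:] ^ k * H" "deg_le R (int k - 1)" by blast
  define r where "r = poly H a / poly G a"
  have "poly (H - smult r G) a = 0" using assms by (simp add: r_def)
  then obtain H' where H': "H - smult r G = [:- a, 1:] * H'"
    using poly_eq_0_iff_dvd[of "H - smult r G" a] by (auto elim: dvdE)
  then have "H = smult r G + [:- a, 1:] * H'" by (simp add: algebra_simps)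
  with RH(1) have "F = (R + smult r ([:- a, 1:] ^ k)) * G + [:- a, 1:] ^ Suc k * H'"
    by (simp add: algebra_simps)
  moreover have "deg_le (R + smult r ([:- a, 1:] ^ k)) (int (Suc k) - 1)"
  proof (rule deg_le_add)
    show "deg_le R (int (Suc k) - 1)" using RH(2) by (rule deg_le_mono) simp
    show "deg_le (smult r ([:- a, 1:] ^ k)) (int (Suc k) - 1)"
      using degree_smult_le[of r "[:- a, 1:] ^ k"] by (simp add: deg_le_def degree_linear_power)
  qed
  ultimately show ?case by blast
qed

text \<open>
  One point is split off at a time: the numerator over \<open>(x - t j)^(m j)\<close> is the Taylor
  polynomial of the quotient of \<open>F\<close> by the other factors. The bound on \<open>Q\<close> needs \<open>- 1 \<le> k\<close>
  to be propagated, since the terms removed from \<open>F\<close> may have degree one less than the full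
  denominator.
\<close>

lemma partial_fractions:
  fixes t :: "'i \<Rightarrow> complex" and m :: "'i \<Rightarrow> nat" and F :: "complex poly"
  assumes "finite I" "inj_on t I" "deg_le F (int (\<Sum>i\<in>I. m i) + k)" "- 1 \<le> k"
  shows "\<exists>R Q. (\<forall>i\<in>I. deg_le (R i) (int (m i) - 1)) \<and> deg_le Q k \<and>
    (\<forall>x. x \<notin> t ` I \<longrightarrow>
       poly F x / (\<Prod>i\<in>I. (x - t i) ^ m i) = (\<Sum>i\<in>I. poly (R i) x / (x - t i) ^ m i) + poly Q x)"
  using assms(1-3)
proof (induction I arbitrary: F rule: finite_induct)
  case empty
  then show ?case by (intro exI[of _ "\<lambda>_. 0"] exI[of _ F]) simp
next
  case (insert j I)
  define G where "G = (\<Prod>i\<in>I. [:- t i, 1:] ^ m i)"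
  define L where "L = [:- t j, 1:] ^ m j"
  have "poly G (t j) \<noteq> 0"
    using insert.hyps insert.prems(1) by (auto simp: G_def poly_prod)
  then obtain R H where RH: "F = R * G + L * H" "deg_le R (int (m j) - 1)"
    using approximate_quotient_at_point[of G "t j" F "m j"] unfolding L_def by blast
  have dG: "degree G = (\<Sum>i\<in>I. m i)"
    unfolding G_def by (subst degree_prod_eq_sum_degree) (simp_all add: degree_linear_power)
  have dL: "degree L = m j" unfolding L_def by (rule degree_linear_power)
  have L0: "L \<noteq> 0" unfolding L_def by simp
  have "deg_le H (int (\<Sum>i\<in>I. m i) + k)"
  proof (cases "H = 0")
    case False
    have "deg_le (R * G) ((int (m j) - 1) + int (\<Sum>i\<in>I. m i))"
      using RH(2) dG by (intro deg_le_mult) (simp_all add: deg_le_def)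
    then have "deg_le (R * G) (int (m j) + int (\<Sum>i\<in>I. m i) + k)"
      by (rule deg_le_mono) (use assms(4) in simp)
    then have "deg_le (F - R * G) (int (m j) + int (\<Sum>i\<in>I. m i) + k)"
      using insert by (intro deg_le_diff) (simp_all add: algebra_simps)
    moreover have "F - R * G = L * H" using RH(1) by simp
    ultimately have "int (degree (L * H)) \<le> int (m j) + int (\<Sum>i\<in>I. m i) + k"
      using False L0 by (simp add: deg_le_def)
    then show ?thesis using False L0 by (simp add: degree_mult_eq dL deg_le_def)
  qed simp
  with insert.IH[of H] insert.prems(1) obtain R' Q where
    R'Q: "\<forall>i\<in>I. deg_le (R' i) (int (m i) - 1)" "deg_le Q k"
      "\<And>x. x \<notin> t ` I \<Longrightarrow> poly H x / (\<Prod>i\<in>I. (x - t i) ^ m i)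
         = (\<Sum>i\<in>I. poly (R' i) x / (x - t i) ^ m i) + poly Q x"
    by auto
  show ?case
  proof (intro exI[of _ "R'(j := R)"] exI[of _ Q] conjI ballI allI impI)
    fix i assume "i \<in> insert j I"
    then show "deg_le ((R'(j := R)) i) (int (m i) - 1)" using RH(2) R'Q(1) by auto
  next
    show "deg_le Q k" by fact
  next
    fix x assume x: "x \<notin> t ` insert j I"
    define g l where "g = (\<Prod>i\<in>I. (x - t i) ^ m i)" and "l = (x - t j) ^ m j"
    have "g \<noteq> 0" "l \<noteq> 0" using x insert.hyps by (auto simp: g_def l_def)
    have "poly F x = poly R x * g + l * poly H x"
      by (simp add: RH(1) G_def L_def g_def l_def poly_prod)
    then have "poly F x / (l * g) = poly R x / l + poly H x / g"
      using \<open>g \<noteq> 0\<close> \<open>l \<noteq> 0\<close> by (simp add: field_simps)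
    also have "poly H x / g = (\<Sum>i\<in>I. poly (R' i) x / (x - t i) ^ m i) + poly Q x"
      unfolding g_def using x by (intro R'Q(3)) auto
    also have "(\<Sum>i\<in>I. poly (R' i) x / (x - t i) ^ m i) =
        (\<Sum>i\<in>I. poly ((R'(j := R)) i) x / (x - t i) ^ m i)"
      using insert.hyps by (intro sum.cong) auto
    finally show "poly F x / (\<Prod>i\<in>insert j I. (x - t i) ^ m i) =
        (\<Sum>i\<in>insert j I. poly ((R'(j := R)) i) x / (x - t i) ^ m i) + poly Q x"
      using insert.hyps by (simp add: g_def l_def)
  qed
qed

section \<open>Pole orders\<close>

lemma pole_order_le_analytic: "f analytic_on {a} \<Longrightarrow> pole_order_le f a 0"
  unfolding pole_order_le_def by (intro exI[of _ f]) auto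

lemma pole_order_le_times_powi:
  assumes "pole_order_le f a k"
  shows "pole_order_le (\<lambda>z. f z * (z - a) powi j) a (k - j)"
proof -
  obtain g where g: "g analytic_on {a}" "\<forall>\<^sub>F z in at a. f z = g z * (z - a) powi (- k)"
    using assms by (auto simp: pole_order_le_def)
  have "\<forall>\<^sub>F z in at a. f z * (z - a) powi j = g z * (z - a) powi (- (k - j))"
    using g(2) eventually_neq_at_within[of a]
    by eventually_elim (simp add: power_int_add[symmetric] add.commute)
  with g(1) show ?thesis unfolding pole_order_le_def by blast
qed

lemma pole_order_le_mono:
  assumes "pole_order_le f a j" "j \<le> k"
  shows "pole_order_le f a k"
proof -
  obtain g where g: "g analytic_on {a}" "\<forall>\<^sub>F z in at a. f z = g z * (z - a) powi (- j)"
    using assms by (auto simp: pole_order_le_def)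
  have "\<forall>\<^sub>F z in at a. f z = (g z * (z - a) ^ nat (k - j)) * (z - a) powi (- k)"
    using g(2) eventually_neq_at_within[of a]
  proof eventually_elim
    case (elim z)
    then show ?case using assms(2)
      by (simp add: power_int_add[symmetric] mult.assoc flip: power_int_of_nat)
  qed
  moreover have "(\<lambda>z. g z * (z - a) ^ nat (k - j)) analytic_on {a}"
    by (intro analytic_intros g(1))
  ultimately show ?thesis unfolding pole_order_le_def by blast
qed

lemma pole_order_le_add:
  assumes "pole_order_le f a k" "pole_order_le h a k"
  shows "pole_order_le (\<lambda>z. f z + h z) a k"
proof -
  obtain g g' where g: "g analytic_on {a}" "\<forall>\<^sub>F z in at a. f z = g z * (z - a) powi (- k)"
    "g' analytic_on {a}" "\<forall>\<^sub>F z in at a. h z = g' z * (z - a) powi (- k)"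
    using assms by (auto simp: pole_order_le_def)
  have "\<forall>\<^sub>F z in at a. f z + h z = (g z + g' z) * (z - a) powi (- k)"
    using g(2,4) by eventually_elim (simp add: algebra_simps)
  moreover have "(\<lambda>z. g z + g' z) analytic_on {a}"
    by (intro analytic_intros g)
  ultimately show ?thesis unfolding pole_order_le_def by blast
qed

lemma pole_order_le_mult_analytic:
  assumes "pole_order_le f a k" "h analytic_on {a}"
  shows "pole_order_le (\<lambda>z. h z * f z) a k"
proof -
  obtain g where g: "g analytic_on {a}" "\<forall>\<^sub>F z in at a. f z = g z * (z - a) powi (- k)"
    using assms by (auto simp: pole_order_le_def)
  have "\<forall>\<^sub>F z in at a. h z * f z = (h z * g z) * (z - a) powi (- k)"
    using g(2) by eventually_elim (simp add: algebra_simps)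
  moreover have "(\<lambda>z. h z * g z) analytic_on {a}"
    by (intro analytic_intros g assms)
  ultimately show ?thesis unfolding pole_order_le_def by blast
qed

text \<open>
  Liouville's theorem. The exponent is an integer because twists of negative degree occur, and
  then the function has to vanish.
\<close>

lemma polynomial_of_entire_growth:
  assumes hol: "h holomorphic_on UNIV"
    and growth: "\<forall>\<^sub>F x in at_infinity. norm (h x) \<le> K * norm x powi N"
  obtains F where "deg_le F N" "\<And>x. h x = poly F x"
proof (cases "0 \<le> N")
  case True
  then obtain M where M: "N = int M" using nonneg_int_cases by blast
  obtain A where "\<And>x. A \<le> norm x \<Longrightarrow> norm (h x) \<le> K * norm x ^ M"
    using growth by (auto simp: eventually_at_infinity M)
  then have *: "h x = (\<Sum>k\<le>M. (deriv ^^ k) h 0 / fact k * x ^ k)" for x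
    using Liouville_polynomial[OF hol] by blast
  show ?thesis
  proof
    show "deg_le (\<Sum>k\<le>M. monom ((deriv ^^ k) h 0 / fact k) k) N"
      by (intro deg_le_sum) (auto simp: M deg_le_iff_coeff)
    show "h x = poly (\<Sum>k\<le>M. monom ((deriv ^^ k) h 0 / fact k) k) x" for x
      by (simp add: poly_sum poly_monom *)
  qed
next
  case False
  have "\<forall>\<^sub>F x :: complex in at_infinity. 1 \<le> norm x"
    by (auto simp: eventually_at_infinity)
  with growth have "\<forall>\<^sub>F x in at_infinity. norm (h x) \<le> \<bar>K\<bar> * inverse (norm x)"
  proof eventually_elim
    case (elim x)
    have "K * norm x powi N \<le> \<bar>K\<bar> * norm x powi N"
      by (intro mult_right_mono) auto
    also have "norm x powi N \<le> norm x powi (- 1)"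
      using elim False by (intro power_int_increasing) auto
    finally show ?case using elim by (simp add: power_int_minus mult_left_mono)
  qed
  moreover have "((\<lambda>x :: complex. \<bar>K\<bar> * inverse (norm x)) \<longlongrightarrow> \<bar>K\<bar> * 0) at_infinity"
    by (intro tendsto_intros tendsto_inverse_0_at_top filterlim_norm_at_top)
  ultimately have "(h \<longlongrightarrow> 0) at_infinity"
    using Lim_null_comparison by fastforce
  then have "h x = 0" for x using Liouville_weak_0[OF hol] by blast
  then show ?thesis by (intro that[of 0]) auto
qed

lemma norm_prod_linear_le:
  fixes x :: complex
  assumes "1 \<le> norm x" "finite S"
  shows "norm (\<Prod>a\<in>S. (x - a) ^ e a) \<le> (\<Prod>a\<in>S. (1 + norm a) ^ e a) * norm x ^ (\<Sum>a\<in>S. e a)"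
proof -
  have "norm (x - a) \<le> (1 + norm a) * norm x" for a
  proof -
    have "norm (x - a) \<le> norm x + norm a" by (rule norm_triangle_ineq4)
    also have "norm a \<le> norm a * norm x" using mult_left_mono[OF assms(1), of "norm a"] by simp
    finally show ?thesis by (simp add: algebra_simps)
  qed
  then have "norm (\<Prod>a\<in>S. (x - a) ^ e a) \<le> (\<Prod>a\<in>S. ((1 + norm a) * norm x) ^ e a)"
    by (simp add: prod_norm[symmetric] norm_power) (intro prod_mono, auto intro: power_mono)
  then show ?thesis by (simp add: power_mult_distrib prod.distrib power_sum)
qed

text \<open>
  This is the description of the global sections of a line bundle on the projective line with
  prescribed poles: clearing the denominators gives an entire function, and its growth is bounded
  by the pole order at \<open>y = 0\<close> of \<open>f'\<close>, which is \<open>f\<close> in the coordinate \<open>y = 1/x\<close>. The degree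
  bounds on the entries of connection matrices come from here.
\<close>

lemma rational_of_pole_orders:
  assumes S: "finite S"
    and an: "\<And>a. a \<notin> S \<Longrightarrow> f analytic_on {a}"
    and po: "\<And>a. a \<in> S \<Longrightarrow> pole_order_le f a (int (e a))"
    and inf: "pole_order_le f' 0 k" "\<forall>\<^sub>F x in at_infinity. f x = f' (1 / x)"
  obtains F where "deg_le F (int (\<Sum>a\<in>S. e a) + k)"
    "\<And>x. x \<notin> S \<Longrightarrow> f x = poly F x / (\<Prod>a\<in>S. (x - a) ^ e a)"
proof -
  define P where "P x = (\<Prod>a\<in>S. (x - a) ^ e a)" for x
  define h where "h = remove_sings (\<lambda>x. P x * f x)"
  have P_an: "P analytic_on A" for A unfolding P_def by (intro analytic_intros)
  have off: "(\<lambda>x. P x * f x) analytic_on {a}" if "a \<notin> S" for a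
    by (intro analytic_intros P_an an that)
  then have h_eq: "h x = P x * f x" if "x \<notin> S" for x
    unfolding h_def using that by simp
  have "h analytic_on {a}" for a
  proof (cases "a \<in> S")
    case False
    then show ?thesis unfolding h_def using off remove_sings_analytic_on by blast
  next
    case True
    obtain g where g: "g analytic_on {a}" "\<forall>\<^sub>F z in at a. f z = g z * (z - a) powi (- int (e a))"
      using po[OF True] by (auto simp: pole_order_le_def)
    define Q where "Q x = (\<Prod>b\<in>S - {a}. (x - b) ^ e b)" for x
    \<comment> \<open>The singularity of \<open>P f\<close> at a point of \<open>S\<close> is removable.\<close>
    have Pf: "\<forall>\<^sub>F z in at a. P z * f z = Q z * g z"
      using g(2) eventually_neq_at_within[of a]
    proof eventually_elim
      case (elim z)
      have "P z = (z - a) ^ e a * Q z"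
        unfolding P_def Q_def using S True by (simp add: prod.remove)
      then show ?case using elim by (simp add: power_int_minus field_simps)
    qed
    have Qg: "(\<lambda>z. Q z * g z) analytic_on {a}"
      unfolding Q_def by (intro analytic_intros g(1))
    then have "(\<lambda>z. Q z * g z) \<midarrow>a\<rightarrow> Q a * g a"
      using analytic_at_imp_isCont isContD by blast
    then have "(\<lambda>z. P z * f z) \<midarrow>a\<rightarrow> Q a * g a"
      using tendsto_cong[OF Pf] by simp
    moreover have "isolated_singularity_at (\<lambda>z. P z * f z) a"
      using isolated_singularity_at_cong[OF Pf refl] isolated_singularity_at_analytic[OF Qg] by simp
    ultimately show ?thesis unfolding h_def by (intro remove_sings_analytic_at)
  qed
  then have hol: "h holomorphic_on UNIV"
    using analytic_on_analytic_at analytic_imp_holomorphic by blast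
  obtain g where g: "g analytic_on {0}" "\<forall>\<^sub>F z in at 0. f' z = g z * z powi (- k)"
    using inf(1) by (auto simp: pole_order_le_def)
  have "(g \<longlongrightarrow> g 0) (at 0)"
    using g(1) analytic_at_imp_isCont isContD by blast
  then have "((\<lambda>z. norm (g z)) \<longlongrightarrow> norm (g 0)) (at 0)" by (rule tendsto_norm)
  then have "\<forall>\<^sub>F z in at 0. norm (g z) < norm (g 0) + 1"
    by (rule order_tendstoD) simp
  with g(2) have near0: "\<forall>\<^sub>F z in at 0. norm (f' z) \<le> (norm (g 0) + 1) * norm z powi (- k)"
    by eventually_elim (simp add: norm_mult norm_power_int mult_right_mono)
  have "filterlim (\<lambda>x :: complex. inverse x) (at 0) at_infinity"
    by (simp add: filterlim_inverse_at_iff filterlim_ident)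
  with near0 have far: "\<forall>\<^sub>F x in at_infinity.
      norm (f' (inverse x)) \<le> (norm (g 0) + 1) * norm (inverse x) powi (- k)"
    by (rule eventually_compose_filterlim)
  define K where "K = (\<Prod>a\<in>S. (1 + norm a) ^ e a)"
  have K0: "0 \<le> K" unfolding K_def by (intro prod_nonneg) auto
  have big: "\<forall>\<^sub>F x :: complex in at_infinity. 1 + (\<Sum>a\<in>S. norm a) \<le> norm x"
    by (auto simp: eventually_at_infinity)
  have "\<forall>\<^sub>F x in at_infinity. norm (h x) \<le> K * (norm (g 0) + 1) * norm x powi (int (\<Sum>a\<in>S. e a) + k)"
    using far inf(2) big
  proof eventually_elim
    case (elim x)
    have x1: "1 \<le> norm x" using elim(3) sum_nonneg[of S norm] by simp
    have "x \<notin> S"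
    proof
      assume "x \<in> S"
      then have "norm x \<le> (\<Sum>a\<in>S. norm a)" using S by (intro member_le_sum) auto
      then show False using elim(3) by simp
    qed
    have fx: "norm (f x) \<le> (norm (g 0) + 1) * norm x powi k"
      using elim(1,2) by (simp add: inverse_eq_divide norm_divide power_int_minus power_int_divide_distrib)
    have "norm (h x) = norm (P x) * norm (f x)"
      using h_eq[OF \<open>x \<notin> S\<close>] by (simp add: norm_mult)
    also have "\<dots> \<le> (K * norm x ^ (\<Sum>a\<in>S. e a)) * ((norm (g 0) + 1) * norm x powi k)"
      using norm_prod_linear_le[OF x1 S, of e] fx K0
      by (intro mult_mono) (auto simp: P_def K_def)
    also have "\<dots> = K * (norm (g 0) + 1) * norm x powi (int (\<Sum>a\<in>S. e a) + k)"
    proof -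
      have "x \<noteq> 0" using x1 by auto
      then show ?thesis by (simp only: power_int_add norm_eq_zero power_int_of_nat simp_thms) simp
    qed
    finally show ?case .
  qed
  then obtain F where "deg_le F (int (\<Sum>a\<in>S. e a) + k)" "\<And>x. h x = poly F x"
    using polynomial_of_entire_growth[OF hol] by blast
  moreover have "f x = poly F x / P x" if "x \<notin> S" for x
  proof -
    have "P x \<noteq> 0" using that S by (auto simp: P_def)
    then show ?thesis using h_eq[OF that] calculation(2)[of x] by (simp add: field_simps)
  qed
  ultimately show ?thesis using that unfolding P_def by blast
qed

section \<open>Isomorphisms of bundles\<close>

lemma mat_holomorphic_on_mult:
  "mat_holomorphic_on M S \<Longrightarrow> mat_holomorphic_on K S \<Longrightarrow> mat_holomorphic_on (\<lambda>z. M z ** K z) S"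
  unfolding mat_holomorphic_on_def matrix_matrix_mult_def
  by (auto intro!: holomorphic_intros)

lemma mat_holomorphic_on_inv:
  assumes "mat_holomorphic_on M S" "\<And>z. z \<in> S \<Longrightarrow> det (M z) \<noteq> 0"
  shows "mat_holomorphic_on (\<lambda>z. matrix_inv (M z)) S"
proof -
  have h: "(\<lambda>z. M z $ i $ j) holomorphic_on S" for i j
    using assms(1) by (simp add: mat_holomorphic_on_def)
  have d: "(\<lambda>z. det (M z)) holomorphic_on S"
    unfolding det_2 by (intro holomorphic_intros h)
  have "(\<lambda>z. matrix_inv (M z) $ i $ j) holomorphic_on S" for i j
  proof -
    have "(\<lambda>z. mat2 (M z $ 2 $ 2 / det (M z)) (- M z $ 1 $ 2 / det (M z))
        (- M z $ 2 $ 1 / det (M z)) (M z $ 1 $ 1 / det (M z)) $ i $ j) holomorphic_on S"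
      using exhaust_2[of i] exhaust_2[of j]
      by (auto simp: assms(2) intro!: holomorphic_intros h d)
    then show ?thesis
      by (rule holomorphic_transform) (simp add: matrix_inv_cmat assms(2))
  qed
  then show ?thesis by (simp add: mat_holomorphic_on_def)
qed

lemma bundle_iso_inverse:
  assumes "bundle_iso G H \<sigma>"
  shows "bundle_iso H G (\<lambda>x. matrix_inv (fst \<sigma> x), \<lambda>y. matrix_inv (snd \<sigma> y))"
proof -
  have *: "matrix_inv (fst \<sigma> x) ** H x = G x ** matrix_inv (snd \<sigma> (1 / x))" if "x \<noteq> 0" for x
  proof -
    have d: "det (fst \<sigma> x) \<noteq> 0" "det (snd \<sigma> (1 / x)) \<noteq> 0" and
      c: "fst \<sigma> x ** G x = H x ** snd \<sigma> (1 / x)"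
      using assms that by (auto simp: bundle_iso_def)
    have "matrix_inv (fst \<sigma> x) ** H x =
        matrix_inv (fst \<sigma> x) ** (H x ** snd \<sigma> (1 / x)) ** matrix_inv (snd \<sigma> (1 / x))"
      using d by (simp add: matrix_inv_left_right flip: matrix_mul_assoc)
    also have "\<dots> = (matrix_inv (fst \<sigma> x) ** fst \<sigma> x) ** G x ** matrix_inv (snd \<sigma> (1 / x))"
      by (simp only: c[symmetric] matrix_mul_assoc)
    finally show ?thesis using d by (simp add: matrix_inv_left_right)
  qed
  with assms show ?thesis
    unfolding bundle_iso_def by (auto simp: det_matrix_inv_nonzero intro: mat_holomorphic_on_inv)
qed

lemma bundle_iso_comp:
  assumes "bundle_iso G H \<sigma>" "bundle_iso H K \<tau>"
  shows "bundle_iso G K (\<lambda>x. fst \<tau> x ** fst \<sigma> x, \<lambda>y. snd \<tau> y ** snd \<sigma> y)"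
proof -
  have "fst \<tau> x ** fst \<sigma> x ** G x = K x ** (snd \<tau> (1 / x) ** snd \<sigma> (1 / x))" if "x \<noteq> 0" for x
    using assms that by (auto simp: bundle_iso_def) (metis matrix_mul_assoc)
  with assms show ?thesis
    unfolding bundle_iso_def by (auto intro: mat_holomorphic_on_mult simp: det_mul)
qed

text \<open>
  A section of \<open>O(k)\<close> is a polynomial of degree at most \<open>k\<close>.
\<close>

lemma entire_polynomial_of_transition:
  assumes "f holomorphic_on UNIV" "f' holomorphic_on UNIV"
    and "\<And>x. x \<noteq> 0 \<Longrightarrow> f x = f' (1 / x) * x powi k"
  obtains F where "deg_le F k" "\<And>x. f x = poly F x"
proof -
  have an: "f analytic_on {a}" "f' analytic_on {0}" for a
    using assms(1,2) by (meson analytic_on_holomorphic open_UNIV subset_UNIV)+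
  have pole: "pole_order_le (\<lambda>y. f' y * y powi (- k)) 0 k"
    using pole_order_le_times_powi[OF pole_order_le_analytic[OF an(2)], of "- k"] by simp
  have far: "\<forall>\<^sub>F x in at_infinity. f x = f' (1 / x) * (1 / x) powi (- k)"
    unfolding eventually_at_infinity
  proof (intro exI[of _ 1] allI impI)
    fix x :: complex assume "1 \<le> norm x"
    then have "x \<noteq> 0" by auto
    then show "f x = f' (1 / x) * (1 / x) powi (- k)"
      using assms(3) by (simp add: power_int_minus power_int_divide_distrib)
  qed
  show ?thesis
  proof (rule rational_of_pole_orders[of "{}" f "\<lambda>_. 0", OF _ _ _ pole far])
    fix F assume "deg_le F (int (\<Sum>a\<in>{}. 0) + k)"
      "\<And>x. x \<notin> {} \<Longrightarrow> f x = poly F x / (\<Prod>a\<in>{}. (x - a) ^ 0)"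
    then show ?thesis using that[of F] by simp
  qed (use an in auto)
qed

text \<open>
  The entries of an automorphism of \<open>O \<oplus> O(k)\<close> are sections of \<open>O\<close> (on the diagonal), of
  \<open>O(k)\<close> (below it) and of \<open>O(- k)\<close> (above it); the last bundle has no nonzero section.
\<close>

lemma split_bundle_automorphism:
  assumes "1 \<le> k" "bundle_iso (split_bundle k) (split_bundle k) \<psi>"
  obtains u v g where "u \<noteq> 0" "v \<noteq> 0" "deg_le g k" "\<And>x. fst \<psi> x = mat2 u 0 (poly g x) v"
proof -
  let ?M = "fst \<psi>" and ?M' = "snd \<psi>"
  have hol: "(\<lambda>z. ?M z $ i $ j) holomorphic_on UNIV" "(\<lambda>z. ?M' z $ i $ j) holomorphic_on UNIV" for i j
    using assms(2) by (auto simp: bundle_iso_def mat_holomorphic_on_def)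
  have comm: "?M x ** mat2 1 0 0 (x powi k) = mat2 1 0 0 (x powi k) ** ?M' (1 / x)" if "x \<noteq> 0" for x
    using assms(2) that by (simp add: bundle_iso_def split_bundle_def diag2_eq_mat2)
  have ent: "?M x $ 1 $ 1 = ?M' (1 / x) $ 1 $ 1 * x powi 0"
      "?M x $ 1 $ 2 = ?M' (1 / x) $ 1 $ 2 * x powi (- k)"
      "?M x $ 2 $ 1 = ?M' (1 / x) $ 2 $ 1 * x powi k"
      "?M x $ 2 $ 2 = ?M' (1 / x) $ 2 $ 2 * x powi 0" if "x \<noteq> 0" for x
    using comm[OF that] that
    by (simp_all add: cmat_eq_iff matrix_matrix_mult_def sum_2 power_int_minus field_simps)
  obtain U where U: "deg_le U 0" "\<And>x. ?M x $ 1 $ 1 = poly U x"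
    using entire_polynomial_of_transition[OF hol(1) hol(2) ent(1)] by blast
  obtain Z where Z: "deg_le Z (- k)" "\<And>x. ?M x $ 1 $ 2 = poly Z x"
    using entire_polynomial_of_transition[OF hol(1) hol(2) ent(2)] by blast
  obtain g where g: "deg_le g k" "\<And>x. ?M x $ 2 $ 1 = poly g x"
    using entire_polynomial_of_transition[OF hol(1) hol(2) ent(3)] by blast
  obtain V where V: "deg_le V 0" "\<And>x. ?M x $ 2 $ 2 = poly V x"
    using entire_polynomial_of_transition[OF hol(1) hol(2) ent(4)] by blast
  have "Z = 0" using Z(1) assms(1) by (auto simp: deg_le_def)
  then have M: "?M x = mat2 (poly U 0) 0 (poly g x) (poly V 0)" for x
    using U Z g V deg_le_zero_const[OF U(1)] deg_le_zero_const[OF V(1)]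
    by (simp add: cmat_eq_iff)
  have "det (?M 0) \<noteq> 0" using assms(2) by (simp add: bundle_iso_def)
  then have "poly U 0 \<noteq> 0" "poly V 0 \<noteq> 0" by (simp_all add: M)
  with M g(1) show ?thesis using that by blast
qed

text \<open>
  In the chart at infinity the entry \<open>g\<close> becomes \<open>y^k g (1/y)\<close>, the polynomial with the reversed
  coefficients.
\<close>

lemma split_bundle_unipotent_automorphism:
  assumes "deg_le g (int k)"
  obtains \<psi> where "bundle_iso (split_bundle (int k)) (split_bundle (int k)) \<psi>"
    "\<And>x. fst \<psi> x = mat2 1 0 (poly g x) 1"
proof
  define g' where "g' y = (\<Sum>i\<le>k. coeff g i * y ^ (k - i))" for y
  have g: "poly g x = x ^ k * g' (1 / x)" if "x \<noteq> 0" for x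
  proof -
    have "degree g \<le> k" using assms by (auto simp: deg_le_def)
    then have "poly g x = poly (\<Sum>i\<le>k. monom (coeff g i) i) x"
      by (simp add: poly_as_sum_of_monoms')
    also have "\<dots> = (\<Sum>i\<le>k. coeff g i * x ^ i)"
      by (simp add: poly_sum poly_monom)
    also have "\<dots> = x ^ k * g' (1 / x)"
      unfolding g'_def sum_distrib_left using that
      by (intro sum.cong) (auto simp: power_divide power_diff field_simps)
    finally show ?thesis .
  qed
  have hol: "mat_holomorphic_on (\<lambda>x. mat2 1 0 (h x) 1) UNIV" if "h holomorphic_on UNIV" for h
    unfolding mat_holomorphic_on_def forall_2 using that by simp
  show "bundle_iso (split_bundle (int k)) (split_bundle (int k))
      (\<lambda>x. mat2 1 0 (poly g x) 1, \<lambda>y. mat2 1 0 (g' y) 1)"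
    unfolding bundle_iso_def split_bundle_def diag2_eq_mat2
    by (auto simp: mat2_mult g g'_def intro!: hol holomorphic_intros)
qed simp

section \<open>Transport of meromorphic connections\<close>

text \<open>
  The entries are written as combinations of the entries of \<open>W\<close> with coefficients that are
  analytic where \<open>M\<close> is holomorphic and invertible, so that pole orders can be read off.
\<close>

lemma gauge_entry:
  "gauge M W x $ i $ j = (\<Sum>k\<in>UNIV. \<Sum>l\<in>UNIV. (M x $ i $ l * matrix_inv (M x) $ k $ j) * W x $ l $ k)
     - (\<Sum>k\<in>UNIV. deriv (\<lambda>z. M z $ i $ k) x * matrix_inv (M x) $ k $ j)"
  by (simp add: gauge_def matrix_matrix_mult_def mat_deriv_def sum_2 algebra_simps)

lemma entire_mat_entries_analytic:
  assumes M: "mat_holomorphic_on M UNIV" "\<And>z. det (M z) \<noteq> 0"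
  shows "(\<lambda>z. M z $ i $ j) analytic_on {a}" "(\<lambda>z. deriv (\<lambda>w. M w $ i $ j) z) analytic_on {a}"
    "(\<lambda>z. matrix_inv (M z) $ i $ j) analytic_on {a}"
proof -
  have an: "f analytic_on {a}" if "f holomorphic_on UNIV" for f
    using that by (meson analytic_on_holomorphic open_UNIV subset_UNIV)
  show "(\<lambda>z. M z $ i $ j) analytic_on {a}" "(\<lambda>z. deriv (\<lambda>w. M w $ i $ j) z) analytic_on {a}"
    "(\<lambda>z. matrix_inv (M z) $ i $ j) analytic_on {a}"
    using M(1) mat_holomorphic_on_inv[OF M(1)] M(2)
    by (auto simp: mat_holomorphic_on_def intro!: an holomorphic_deriv)
qed

lemma gauge_pole_order:
  assumes M: "mat_holomorphic_on M UNIV" "\<And>z. det (M z) \<noteq> 0"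
    and W: "\<And>i j. pole_order_le (\<lambda>z. W z $ i $ j) a k" and k: "0 \<le> k"
  shows "pole_order_le (\<lambda>z. gauge M W z $ i $ j) a k"
proof -
  note M_an = entire_mat_entries_analytic[OF M]
  have add: "pole_order_le (\<lambda>z. \<Sum>l\<in>UNIV. f l z) a k" if "\<And>l :: 2. pole_order_le (f l) a k" for f
    unfolding sum_2 by (intro pole_order_le_add that)
  have 1: "pole_order_le (\<lambda>z. \<Sum>k\<in>UNIV. \<Sum>l\<in>UNIV. (M z $ i $ l * matrix_inv (M z) $ k $ j) * W z $ l $ k) a k"
    by (intro add pole_order_le_mult_analytic analytic_intros M_an W)
  have 2: "pole_order_le (\<lambda>z. - (\<Sum>k\<in>UNIV. deriv (\<lambda>w. M w $ i $ k) z * matrix_inv (M z) $ k $ j)) a k"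
    by (rule pole_order_le_mono[OF pole_order_le_analytic k], intro analytic_intros M_an)
  show ?thesis
    unfolding gauge_entry using pole_order_le_add[OF 1 2] by simp
qed

lemma gauge_analytic:
  assumes M: "mat_holomorphic_on M UNIV" "\<And>z. det (M z) \<noteq> 0"
    and W: "\<And>i j. (\<lambda>z. W z $ i $ j) analytic_on {a}"
  shows "(\<lambda>z. gauge M W z $ i $ j) analytic_on {a}"
proof -
  note M_an = entire_mat_entries_analytic[OF M]
  show ?thesis unfolding gauge_entry by (intro analytic_intros M_an W)
qed

text \<open>
  Transport by a bundle isomorphism keeps the pole orders, because its two matrices are
  holomorphic and invertible on their charts. The compatibility of the two charts is transported
  by composing gauge transformations along \<open>\<sigma>\<^sub>x G = H \<sigma>\<^sub>y (1/x)\<close>.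
\<close>

lemma meromorphic_connection_push:
  assumes N: "meromorphic_connection D N" and \<sigma>: "bundle_iso (cocycle N) H \<sigma>"
    and H: "holomorphic_bundle H" and D: "\<And>p. 0 \<le> D p"
  shows "meromorphic_connection D (push \<sigma> H N)"
proof -
  have hol: "mat_holomorphic_on (fst \<sigma>) UNIV" "mat_holomorphic_on (snd \<sigma>) UNIV"
    and det: "det (fst \<sigma> x) \<noteq> 0" "det (snd \<sigma> x) \<noteq> 0" for x
    using \<sigma> by (auto simp: bundle_iso_def)
  have Npole: "pole_order_le (\<lambda>z. local_form N p z $ i $ j) (coord p) (D p)" for p i j
    using N by (auto simp: meromorphic_connection_def)
  have Nan: "(\<lambda>z. local_form N p z $ i $ j) analytic_on {coord p}" if "p \<notin> div_support D" for p i j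
    using N that by (auto simp: meromorphic_connection_def)
  have "pole_order_le (\<lambda>z. local_form (push \<sigma> H N) p z $ i $ j) (coord p) (D p)" for p i j
    using gauge_pole_order[OF hol(1) det(1) Npole[of p] D] gauge_pole_order[OF hol(2) det(2) Npole[of p] D]
    by (cases p) (auto simp: local_form_def push_def)
  moreover have "(\<lambda>z. local_form (push \<sigma> H N) p z $ i $ j) analytic_on {coord p}"
    if "p \<notin> div_support D" for p i j
    using gauge_analytic[OF hol(1) det(1) Nan[OF that]] gauge_analytic[OF hol(2) det(2) Nan[OF that]]
    by (cases p) (auto simp: local_form_def push_def)
  moreover have "gauge (fst \<sigma>) (form_aff N) x =
      gauge H (\<lambda>x. scale_mat (- 1 / x ^ 2) (gauge (snd \<sigma>) (form_inf N) (1 / x))) x"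
    if x: "x \<noteq> 0" "Aff x \<notin> div_support D" for x
  proof -
    let ?V = "\<lambda>x. scale_mat (- 1 / x ^ 2) (form_inf N (1 / x))"
    let ?S = "\<lambda>x. snd \<sigma> (1 / x)"
    have G: "mat_differentiable (cocycle N) x" "det (cocycle N x) \<noteq> 0"
      using N x mat_holomorphic_on_imp_differentiable[of "cocycle N" "- {0}" x]
      by (auto simp: meromorphic_connection_def holomorphic_bundle_def)
    have Hx: "mat_differentiable H x" "det (H x) \<noteq> 0"
      using H x mat_holomorphic_on_imp_differentiable[of H "- {0}" x]
      by (auto simp: holomorphic_bundle_def)
    have S: "mat_differentiable (fst \<sigma>) x" "mat_differentiable (snd \<sigma>) (1 / x)"
      using hol by (auto intro: mat_holomorphic_on_imp_differentiable)
    have S': "mat_differentiable ?S x"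
    proof -
      have "(\<lambda>z. ?S z $ i $ j) holomorphic_on - {0}" for i j
        using hol(2) unfolding mat_holomorphic_on_def
        by (intro holomorphic_on_compose_gen[of "\<lambda>z. 1 / z" "- {0}" "\<lambda>z. snd \<sigma> z $ i $ j" UNIV, unfolded o_def])
           (auto intro!: holomorphic_intros)
      then show ?thesis
        using x(1) mat_holomorphic_on_imp_differentiable[of ?S "- {0}" x] by (auto simp: mat_holomorphic_on_def)
    qed
    have "form_aff N x = gauge (cocycle N) ?V x"
      using N x by (simp add: meromorphic_connection_def)
    then have "gauge (fst \<sigma>) (form_aff N) x = gauge (fst \<sigma>) (gauge (cocycle N) ?V) x"
      by (intro gauge_cong) auto
    also have "\<dots> = gauge (\<lambda>z. fst \<sigma> z ** cocycle N z) ?V x"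
      using S G det by (intro gauge_mult[symmetric])
    also have "\<dots> = gauge (\<lambda>z. H z ** ?S z) ?V x"
    proof (rule gauge_cong)
      have "\<forall>\<^sub>F z in nhds x. z \<in> - {0}"
        using x(1) by (intro eventually_nhds_in_open) auto
      then show "\<forall>\<^sub>F z in nhds x. fst \<sigma> z ** cocycle N z = H z ** ?S z"
        by eventually_elim (use \<sigma> in \<open>auto simp: bundle_iso_def\<close>)
    qed simp
    also have "\<dots> = gauge H (gauge ?S ?V) x"
      using Hx S' det by (intro gauge_mult)
    also have "\<dots> = gauge H (\<lambda>x. scale_mat (- 1 / x ^ 2) (gauge (snd \<sigma>) (form_inf N) (1 / x))) x"
      using gauge_inverse_arg[OF S(2) x(1)] by (intro gauge_cong) auto
    finally show ?thesis .
  qed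
  ultimately show ?thesis
    using H by (auto simp: meromorphic_connection_def push_def)
qed

section \<open>Connections on \<open>O \<oplus> O(k)\<close> as matrices of rational functions\<close>

abbreviation affine_support :: "divisor \<Rightarrow> complex set" where
  "affine_support D \<equiv> {a. Aff a \<in> div_support D}"

definition effective :: "divisor \<Rightarrow> bool" where
  "effective D \<longleftrightarrow> finite (div_support D) \<and> (\<forall>p. 0 \<le> D p)"

lemma finite_affine_support: "effective D \<Longrightarrow> finite (affine_support D)"
  unfolding effective_def
  using finite_vimageI[of "div_support D" Aff] by (simp add: vimage_def inj_def)

lemma div_poly_nonzero: "effective D \<Longrightarrow> Aff x \<notin> div_support D \<Longrightarrow> div_poly D x \<noteq> 0"
  by (auto simp: div_poly_def finite_affine_support)

lemma div_support_subset: "div_support D \<subseteq> Aff ` affine_support D \<union> {Infty}"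
proof
  fix p assume "p \<in> div_support D"
  then show "p \<in> Aff ` affine_support D \<union> {Infty}" by (cases p) auto
qed

lemma div_degree_eq:
  assumes "effective D"
  shows "div_degree D = int (\<Sum>a\<in>affine_support D. nat (D (Aff a))) + D Infty"
proof -
  have "div_degree D = (\<Sum>p\<in>Aff ` affine_support D \<union> {Infty}. D p)"
    unfolding div_degree_def using finite_affine_support[OF assms]
    by (intro sum.mono_neutral_left div_support_subset) (auto simp: div_support_def)
  also have "\<dots> = (\<Sum>p\<in>Aff ` affine_support D. D p) + D Infty"
    using finite_affine_support[OF assms] by (subst sum.union_disjoint) auto
  also have "(\<Sum>p\<in>Aff ` affine_support D. D p) = (\<Sum>a\<in>affine_support D. D (Aff a))"
    by (subst sum.reindex) (auto simp: inj_on_def)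
  finally show ?thesis using assms by (simp add: effective_def)
qed

lemma eventually_nhds_not_affine_support:
  assumes "effective D" "Aff x \<notin> div_support D"
  shows "\<forall>\<^sub>F z in nhds x. Aff z \<notin> div_support D"
proof -
  have "\<forall>\<^sub>F z in nhds x. z \<in> - affine_support D"
    using assms finite_affine_support[OF assms(1)]
    by (intro eventually_nhds_in_open) (auto intro: finite_imp_closed)
  then show ?thesis by simp
qed

lemma poly_eq_off_finite:
  fixes p q :: "complex poly"
  assumes "finite S" "\<And>x. x \<notin> S \<Longrightarrow> poly p x = poly q x"
  shows "p = q"
proof (rule ccontr)
  assume "p \<noteq> q"
  then have "finite {x. poly (p - q) x = 0}" by (intro poly_roots_finite) simp
  then have "finite (S \<union> {x. poly (p - q) x = 0})" using assms(1) by blast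
  moreover have "S \<union> {x. poly (p - q) x = 0} = UNIV" using assms(2) by auto
  ultimately show False using infinite_UNIV_char_0[where 'a = complex] by metis
qed

definition rational_form ::
    "divisor \<Rightarrow> connection \<Rightarrow> complex poly \<Rightarrow> complex poly \<Rightarrow> complex poly \<Rightarrow> complex poly \<Rightarrow> bool" where
  "rational_form D T A B C E \<longleftrightarrow> (\<forall>x. Aff x \<notin> div_support D \<longrightarrow> form_aff T x =
     mat2 (poly A x / div_poly D x) (poly B x / div_poly D x)
          (poly C x / div_poly D x) (poly E x / div_poly D x))"

lemma holomorphic_bundle_split: "holomorphic_bundle (split_bundle k)"
  unfolding holomorphic_bundle_def mat_holomorphic_on_def split_bundle_def diag2_eq_mat2 forall_2
  by (auto intro!: holomorphic_intros)

text \<open>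
  The \<open>(i,j)\<close> entry is a section of \<open>\<Omega>\<^sup>1(D)\<close>, of degree \<open>deg D - 2\<close>, twisted by \<open>0\<close>, \<open>k\<close> or
  \<open>- k\<close>. Only the lower diagonal entry is not \<open>O\<close>-linear: differentiating the cocycle adds
  \<open>- k/x\<close> to it, a simple pole at infinity, which \<open>D\<close> absorbs as it contains infinity.
\<close>

lemma split_bundle_connection_rational:
  assumes T: "meromorphic_connection D T" "cocycle T = split_bundle k"
    and D: "effective D" "1 \<le> D Infty"
  obtains A B C E where "rational_form D T A B C E"
    "deg_le A (div_degree D - 2)" "deg_le B (div_degree D - 2 - k)"
    "deg_le C (div_degree D - 2 + k)" "deg_le E (div_degree D - 2)"
proof -
  let ?P = "div_poly D"
  have fin: "finite (affine_support D)" using D(1) by (rule finite_affine_support)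
  have infty: "form_aff T x = mat2
      (- form_inf T (1 / x) $ 1 $ 1 * x powi (- 2)) (- form_inf T (1 / x) $ 1 $ 2 * x powi (- k - 2))
      (- form_inf T (1 / x) $ 2 $ 1 * x powi (k - 2)) (- form_inf T (1 / x) $ 2 $ 2 * x powi (- 2) - of_int k / x)"
    if x: "x \<noteq> 0" "Aff x \<notin> div_support D" for x
  proof -
    let ?w = "\<lambda>i j. - form_inf T (1 / x) $ i $ j / x ^ 2"
    have "form_aff T x = gauge (split_bundle k) (\<lambda>x. scale_mat (- 1 / x ^ 2) (form_inf T (1 / x))) x"
      using T x by (simp add: meromorphic_connection_def)
    also have "\<dots> = mat2 (?w 1 1 - ?w 1 2 * 0 / (x powi k) - 0 / 1) (1 * ?w 1 2 / (x powi k))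
       ((0 * ?w 1 1 + x powi k * ?w 2 1) / 1 - (0 * ?w 1 2 + x powi k * ?w 2 2) * 0 / (1 * x powi k)
          - 0 / 1 + (of_int k * x powi (k - 1)) * 0 / (1 * x powi k))
       (0 * ?w 1 2 / (x powi k) + ?w 2 2 - (of_int k * x powi (k - 1)) / x powi k)"
    proof (rule gauge_lower_triangular)
      show "\<forall>\<^sub>F z in nhds x. split_bundle k z = mat2 1 0 0 (z powi k)"
        by (simp add: split_bundle_def diag2_eq_mat2)
      show "((\<lambda>z. z powi k) has_field_derivative of_int k * x powi (k - 1)) (at x)"
        using x(1) by (auto intro!: derivative_eq_intros)
      show "scale_mat (- 1 / x ^ 2) (form_inf T (1 / x)) = mat2 (?w 1 1) (?w 1 2) (?w 2 1) (?w 2 2)"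
        by (simp add: cmat_eq_iff scale_mat_def)
    qed (use x in auto)
    also have "\<dots> = mat2
        (- form_inf T (1 / x) $ 1 $ 1 * x powi (- 2)) (- form_inf T (1 / x) $ 1 $ 2 * x powi (- k - 2))
        (- form_inf T (1 / x) $ 2 $ 1 * x powi (k - 2)) (- form_inf T (1 / x) $ 2 $ 2 * x powi (- 2) - of_int k / x)"
      using x(1) by (simp add: cmat_eq_iff power_int_minus power_int_diff divide_simps)
    finally show ?thesis .
  qed
  \<comment> \<open>The twist is \<open>j\<close>, and \<open>c/x\<close> is the contribution of the derivative of the cocycle.\<close>
  have entry: "\<exists>F. deg_le F (div_degree D - 2 + j) \<and>
      (\<forall>x. Aff x \<notin> div_support D \<longrightarrow> form_aff T x $ i $ l = poly F x / ?P x)"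
    if eq: "\<And>x. x \<noteq> 0 \<Longrightarrow> Aff x \<notin> div_support D \<Longrightarrow>
        form_aff T x $ i $ l = - form_inf T (1 / x) $ i $ l * x powi (j - 2) - c / x"
      and cj: "c = 0 \<or> j = 0" for i l c j
  proof -
    have an: "(\<lambda>x. form_aff T x $ i $ l) analytic_on {a}" if "a \<notin> affine_support D" for a
    proof -
      have "(\<lambda>z. local_form T (Aff a) z $ i $ l) analytic_on {coord (Aff a)}"
        using T(1) that unfolding meromorphic_connection_def by blast
      then show ?thesis by (simp add: local_form_def)
    qed
    have po: "pole_order_le (\<lambda>x. form_aff T x $ i $ l) a (int (nat (D (Aff a))))" for a
    proof -
      have "pole_order_le (\<lambda>z. local_form T (Aff a) z $ i $ l) (coord (Aff a)) (D (Aff a))"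
        using T(1) unfolding meromorphic_connection_def by blast
      then show ?thesis using D(1) by (simp add: local_form_def effective_def)
    qed
    have "pole_order_le (\<lambda>z. local_form T Infty z $ i $ l) (coord Infty) (D Infty)"
      using T(1) unfolding meromorphic_connection_def by blast
    then have "pole_order_le (\<lambda>y. (- 1) * form_inf T y $ i $ l) 0 (D Infty)"
      by (intro pole_order_le_mult_analytic analytic_intros) (simp add: local_form_def)
    then have inf1: "pole_order_le (\<lambda>y. - form_inf T y $ i $ l * y powi (2 - j)) 0 (D Infty - 2 + j)"
      using pole_order_le_times_powi[of "\<lambda>y. (- 1) * form_inf T y $ i $ l" 0 "D Infty" "2 - j"]
      by (simp add: algebra_simps)
    have inf2: "pole_order_le (\<lambda>y. - c * y) 0 (D Infty - 2 + j)"
    proof -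
      have "pole_order_le (\<lambda>y. - c) 0 0"
        by (intro pole_order_le_analytic analytic_intros)
      from pole_order_le_times_powi[OF this, of 1]
      have c1: "pole_order_le (\<lambda>y. - c * y) 0 (- 1)" by simp
      show ?thesis
      proof (cases "j = 0")
        case True
        then show ?thesis using c1 D(2) by (elim pole_order_le_mono) simp
      next
        case False
        then have "c = 0" using cj by simp
        then show ?thesis unfolding pole_order_le_def by (intro exI[of _ "\<lambda>_. 0"]) auto
      qed
    qed
    obtain R where R: "\<And>a. a \<in> affine_support D \<Longrightarrow> norm a \<le> R"
      using finite_imp_bounded[OF fin] by (auto simp: bounded_iff)
    have far: "\<forall>\<^sub>F x in at_infinity. form_aff T x $ i $ l =
        - form_inf T (1 / x) $ i $ l * (1 / x) powi (2 - j) + - c * (1 / x)"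
      unfolding eventually_at_infinity
    proof (intro exI[of _ "\<bar>R\<bar> + 1"] allI impI)
      fix x :: complex assume x: "\<bar>R\<bar> + 1 \<le> norm x"
      then have "x \<noteq> 0" by auto
      moreover have "Aff x \<notin> div_support D" using R[of x] x by auto
      moreover have "(1 / x) powi (2 - j) = x powi (j - 2)"
        using \<open>x \<noteq> 0\<close> power_int_minus[of x "j - 2"]
        by (simp add: power_int_divide_distrib inverse_eq_divide power_int_diff)
      ultimately show "form_aff T x $ i $ l =
          - form_inf T (1 / x) $ i $ l * (1 / x) powi (2 - j) + - c * (1 / x)"
        using eq[of x] by simp
    qed
    show ?thesis
    proof (rule rational_of_pole_orders[OF fin an po pole_order_le_add[OF inf1 inf2] far])
      fix F assume "deg_le F (int (\<Sum>a\<in>affine_support D. nat (D (Aff a))) + (D Infty - 2 + j))"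
        "\<And>x. x \<notin> affine_support D \<Longrightarrow> form_aff T x $ i $ l =
           poly F x / (\<Prod>a\<in>affine_support D. (x - a) ^ nat (D (Aff a)))"
      then show ?thesis
        by (intro exI[of _ F]) (simp add: div_degree_eq[OF D(1)] div_poly_def algebra_simps)
    qed
  qed
  obtain A where A: "deg_le A (div_degree D - 2)"
      "\<And>x. Aff x \<notin> div_support D \<Longrightarrow> form_aff T x $ 1 $ 1 = poly A x / ?P x"
    using entry[of 1 1 0 0] infty by (force simp: algebra_simps)
  obtain B where B: "deg_le B (div_degree D - 2 - k)"
      "\<And>x. Aff x \<notin> div_support D \<Longrightarrow> form_aff T x $ 1 $ 2 = poly B x / ?P x"
    using entry[of 1 2 "- k" 0] infty by (force simp: algebra_simps)
  obtain C where C: "deg_le C (div_degree D - 2 + k)"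
      "\<And>x. Aff x \<notin> div_support D \<Longrightarrow> form_aff T x $ 2 $ 1 = poly C x / ?P x"
    using entry[of 2 1 k 0] infty by (force simp: algebra_simps)
  obtain E where E: "deg_le E (div_degree D - 2)"
      "\<And>x. Aff x \<notin> div_support D \<Longrightarrow> form_aff T x $ 2 $ 2 = poly E x / ?P x"
    using entry[of 2 2 0 "of_int k"] infty by (force simp: algebra_simps)
  show ?thesis
    using that[of A B C E] A B C E by (simp add: rational_form_def cmat_eq_iff)
qed

section \<open>The apparent divisor and the choice of the splitting\<close>

text \<open>
  The factor \<open>div_poly D\<close> vanishes at \<open>a\<close> to the order \<open>D (Aff a)\<close>, so that only the zeros of the
  numerator remain.
\<close>

lemma zorder_rational:
  assumes D: "effective D" and B: "B \<noteq> 0"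
    and f: "\<And>x. Aff x \<notin> div_support D \<Longrightarrow> f x = poly B x / div_poly D x"
  shows "zorder f a + D (Aff a) = int (order a B)"
proof -
  obtain R where R: "B = [:- a, 1:] ^ order a B * R" "\<not> [:- a, 1:] dvd R"
    using order_decomp[OF B] by blast
  define Q where "Q x = (\<Prod>b\<in>affine_support D - {a}. (x - b) ^ nat (D (Aff b)))" for x
  have fin: "finite (affine_support D)" using D by (rule finite_affine_support)
  have P: "div_poly D x = (x - a) ^ nat (D (Aff a)) * Q x" for x
  proof (cases "a \<in> affine_support D")
    case True
    then show ?thesis unfolding div_poly_def Q_def using fin by (rule prod.remove[rotated])
  next
    case False
    then have "D (Aff a) = 0" "affine_support D - {a} = affine_support D"
      by (auto simp: div_support_def)
    then show ?thesis by (simp add: div_poly_def Q_def)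
  qed
  have Q0: "Q x \<noteq> 0" if "x \<notin> affine_support D - {a}" for x
    using that fin by (auto simp: Q_def)
  have "zorder f a = int (order a B) - D (Aff a)"
  proof (rule zorder_eqI)
    show "open (- (affine_support D - {a}))"
      using fin by (intro open_Compl finite_imp_closed) simp
    show "(\<lambda>x. poly R x / Q x) holomorphic_on - (affine_support D - {a})"
    proof (intro holomorphic_intros)
      show "Q holomorphic_on - (affine_support D - {a})"
        unfolding Q_def by (intro holomorphic_intros)
    qed (use Q0 in auto)
    show "poly R a / Q a \<noteq> 0"
      using R(2) Q0[of a] by (simp add: poly_eq_0_iff_dvd)
    fix w assume w: "w \<in> - (affine_support D - {a})" "w \<noteq> a"
    then have "f w = poly B w / div_poly D w" by (intro f) auto
    also have "poly B w = (w - a) ^ order a B * poly R w"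
      by (subst R(1)) simp
    also have "(w - a) ^ order a B * poly R w / div_poly D w =
        poly R w / Q w * (w - a) powi (int (order a B) - D (Aff a))"
      using w D by (simp add: P power_int_diff effective_def mult.commute flip: power_int_of_nat)
    finally show "f w = poly R w / Q w * (w - a) powi (int (order a B) - D (Aff a))" .
  qed auto
  then show ?thesis by simp
qed

text \<open>
  Two splittings differ by an automorphism of \<open>O \<oplus> O(1)\<close>.
\<close>

lemma change_of_splitting:
  assumes "is_splitting N \<sigma>" "is_splitting N \<tau>"
  obtains u v s where "u \<noteq> 0" "v \<noteq> 0"
    "\<And>x. form_aff (split_conn \<tau> N) x =
       gauge (\<lambda>z. mat2 u 0 (poly s z) v) (form_aff (split_conn \<sigma> N)) x"
proof -
  have iso: "bundle_iso (cocycle N) (split_bundle 1) \<sigma>" "bundle_iso (cocycle N) (split_bundle 1) \<tau>"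
    using assms by (simp_all add: is_splitting_def)
  obtain u v s where uvs: "u \<noteq> 0" "v \<noteq> 0"
      "\<And>x. fst \<tau> x ** matrix_inv (fst \<sigma> x) = mat2 u 0 (poly s x) v"
    using split_bundle_automorphism[OF _ bundle_iso_comp[OF bundle_iso_inverse[OF iso(1)] iso(2)]]
    by (metis (no_types, lifting) fst_conv order_refl)
  have "form_aff (split_conn \<tau> N) x =
       gauge (\<lambda>z. mat2 u 0 (poly s z) v) (form_aff (split_conn \<sigma> N)) x" for x
  proof -
    have \<sigma>: "mat_differentiable (fst \<sigma>) x" "det (fst \<sigma> z) \<noteq> 0" for z
      using iso(1) by (auto simp: bundle_iso_def intro: mat_holomorphic_on_imp_differentiable)
    have \<rho>: "mat_differentiable (\<lambda>z. mat2 u 0 (poly s z) v) x"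
      by (rule mat_holomorphic_on_imp_differentiable[of _ UNIV])
         (auto simp: mat_holomorphic_on_def forall_2 intro!: holomorphic_intros)
    have \<tau>: "fst \<tau> z = mat2 u 0 (poly s z) v ** fst \<sigma> z" for z
    proof -
      have "mat2 u 0 (poly s z) v ** fst \<sigma> z = fst \<tau> z ** (matrix_inv (fst \<sigma> z) ** fst \<sigma> z)"
        by (simp only: uvs(3)[symmetric] matrix_mul_assoc)
      then show ?thesis using \<sigma>(2) by (simp add: matrix_inv_left_right)
    qed
    then have "fst \<tau> = (\<lambda>z. mat2 u 0 (poly s z) v ** fst \<sigma> z)" by blast
    then show ?thesis
      using gauge_mult[OF \<rho> \<sigma>(1), of "form_aff N"] \<sigma>(2) uvs(1,2)
      by (simp add: split_conn_def push_def)
  qed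
  with uvs show ?thesis using that by blast
qed

text \<open>
  If \<open>(a, b; c, e) = (A, B; C, E)/P\<close> is the matrix on \<open>O \<oplus> O(1)\<close>, these are the entries
  \<open>c\<^sub>0 = - P det + A B'/B - A'\<close> and \<open>d\<^sub>0 = tr - B'/B\<close> of the normal form. At a simple zero
  \<open>q\<close> of \<open>B\<close> outside \<open>D\<close>, the residue of \<open>c\<^sub>0\<close> is \<open>A q\<close>.
\<close>

definition normal_c :: "divisor \<Rightarrow> complex poly \<Rightarrow> complex poly \<Rightarrow> complex poly \<Rightarrow> complex poly \<Rightarrow> complex \<Rightarrow> complex" where
  "normal_c D A B C E x = poly (B * C - A * E) x / div_poly D x
     + poly A x * (poly (pderiv B) x / poly B x) - poly (pderiv A) x"

definition normal_d :: "divisor \<Rightarrow> complex poly \<Rightarrow> complex poly \<Rightarrow> complex poly \<Rightarrow> complex \<Rightarrow> complex" where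
  "normal_d D A B E x = poly (A + E) x / div_poly D x - poly (pderiv B) x / poly B x"

text \<open>
  The independence of the splitting. A change of splitting replaces \<open>A\<close> by \<open>A - B s/v\<close> and
  multiplies \<open>B\<close> by a constant, hence \<open>B'/B\<close> does not change. The trace does not change because
  the diagonal of the transformation is constant. In \<open>c\<^sub>0\<close> the term
  \<open>- P det\<close> changes by \<open>- B s'/v\<close>, because of the derivative of the transformation, and
  \<open>A B'/B - A'\<close> changes by the opposite amount.
\<close>

lemma rational_form_change:
  assumes D: "effective D" and uv: "u \<noteq> 0" "v \<noteq> 0"
    and W: "rational_form D T A B C E" and W': "rational_form D T' A' B' C' E'"
    and T': "\<And>x. form_aff T' x = gauge (\<lambda>z. mat2 u 0 (poly s z) v) (form_aff T) x"
  shows "B' = smult (u / v) B"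
    and "Aff x \<notin> div_support D \<Longrightarrow> poly B x \<noteq> 0 \<Longrightarrow> normal_c D A' B' C' E' x = normal_c D A B C E x"
    and "Aff x \<notin> div_support D \<Longrightarrow> poly B x \<noteq> 0 \<Longrightarrow> normal_d D A' B' E' x = normal_d D A B E x"
proof -
  let ?P = "div_poly D"
  have fin: "finite (affine_support D)" using D by (rule finite_affine_support)
  have ent: "mat2 (poly A' x / ?P x) (poly B' x / ?P x) (poly C' x / ?P x) (poly E' x / ?P x) =
    mat2 (poly A x / ?P x - poly B x / ?P x * poly s x / v - 0 / u) (u * (poly B x / ?P x) / v)
      ((poly s x * (poly A x / ?P x) + v * (poly C x / ?P x)) / u
        - (poly s x * (poly B x / ?P x) + v * (poly E x / ?P x)) * poly s x / (u * v)
        - poly (pderiv s) x / u + 0 * poly s x / (u * v))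
      (poly s x * (poly B x / ?P x) / v + poly E x / ?P x - 0 / v)" if x: "Aff x \<notin> div_support D" for x
  proof -
    have "form_aff T' x = mat2 (poly A x / ?P x - poly B x / ?P x * poly s x / v - 0 / u) (u * (poly B x / ?P x) / v)
      ((poly s x * (poly A x / ?P x) + v * (poly C x / ?P x)) / u
        - (poly s x * (poly B x / ?P x) + v * (poly E x / ?P x)) * poly s x / (u * v)
        - poly (pderiv s) x / u + 0 * poly s x / (u * v))
      (poly s x * (poly B x / ?P x) / v + poly E x / ?P x - 0 / v)"
      unfolding T' by (rule gauge_lower_triangular)
        (use W x uv in \<open>auto simp: rational_form_def intro!: poly_DERIV\<close>)
    then show ?thesis using W' x by (simp add: rational_form_def)
  qed
  have P: "?P x \<noteq> 0" if "Aff x \<notin> div_support D" for x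
    using D that by (rule div_poly_nonzero)
  show B': "B' = smult (u / v) B"
  proof (rule poly_eq_off_finite[OF fin])
    fix x assume "x \<notin> affine_support D"
    then show "poly B' x = poly (smult (u / v) B) x"
      using ent[of x] P[of x] uv by (simp add: cmat_eq_iff divide_simps)
  qed
  have A': "A' = A - smult (1 / v) (B * s)"
  proof (rule poly_eq_off_finite[OF fin])
    fix x assume "x \<notin> affine_support D"
    then show "poly A' x = poly (A - smult (1 / v) (B * s)) x"
      using ent[of x] P[of x] uv by (simp add: cmat_eq_iff field_simps)
  qed
  assume x: "Aff x \<notin> div_support D" and B: "poly B x \<noteq> 0"
  have E': "poly E' x = poly E x + poly s x * poly B x / v"
    using ent[OF x] P[OF x] uv by (simp add: cmat_eq_iff field_simps)
  have C': "poly C' x = (poly s x * poly A x + v * poly C x) / u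
      - (poly s x * poly B x + v * poly E x) * poly s x / (u * v) - ?P x * poly (pderiv s) x / u"
  proof -
    let ?r = "(poly s x * (poly A x / ?P x) + v * (poly C x / ?P x)) / u
        - (poly s x * (poly B x / ?P x) + v * (poly E x / ?P x)) * poly s x / (u * v) - poly (pderiv s) x / u"
    have "poly C' x / ?P x = ?r" using ent[OF x] by (simp add: cmat_eq_iff)
    then have "poly C' x = ?P x * ?r" using P[OF x] by (metis nonzero_mult_div_cancel_left times_divide_eq_right)
    also have "\<dots> = (poly s x * poly A x + v * poly C x) / u
      - (poly s x * poly B x + v * poly E x) * poly s x / (u * v) - ?P x * poly (pderiv s) x / u"
      using P[OF x] uv by (simp add: field_simps)
    finally show ?thesis .
  qed
  have dB': "poly (pderiv B') x / poly B' x = poly (pderiv B) x / poly B x"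
    using uv B by (simp add: B' pderiv_smult)
  have dA': "poly (pderiv A') x = poly (pderiv A) x
      - (poly (pderiv B) x * poly s x + poly B x * poly (pderiv s) x) / v"
    by (simp add: A' pderiv_diff pderiv_smult pderiv_mult field_simps)
  have vA': "poly A' x = poly A x - poly B x * poly s x / v" by (simp add: A')
  show "normal_c D A' B' C' E' x = normal_c D A B C E x"
    unfolding normal_c_def dB' dA' poly_diff poly_mult vA' C' E'
    using uv P[OF x] B by (simp add: B' field_simps)
  show "normal_d D A' B' E' x = normal_d D A B E x"
    unfolding normal_d_def dB' poly_add vA' E' by (simp add: algebra_simps)
qed

text \<open>
  The apparent divisor is defined by one chosen splitting. Since another splitting multiplies \<open>B\<close>
  by a nonzero constant, its orders of vanishing may be computed in any splitting; for the
  same reason non-invariance of \<open>L\<close> in one splitting gives \<open>B \<noteq> 0\<close> in all.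
\<close>

lemma App_eq_order:
  assumes N: "N \<in> set_U D \<Lambda>" and D: "effective D" "1 \<le> D Infty"
    and \<sigma>: "is_splitting N \<sigma>" and W: "rational_form D (split_conn \<sigma> N) A B C E"
  shows "B \<noteq> 0" "App D N (Aff a) = int (order a B)"
proof -
  have mero: "meromorphic_connection D N" using N by (simp add: set_U_def \<Lambda>_connection_def)
  have other: "\<exists>A' \<kappa> C' E'. \<kappa> \<noteq> 0 \<and> rational_form D (split_conn \<tau> N) A' (smult \<kappa> B) C' E'"
    if \<tau>: "is_splitting N \<tau>" for \<tau>
  proof -
    have "meromorphic_connection D (split_conn \<tau> N)" unfolding split_conn_def
      using mero \<tau> D(1) by (intro meromorphic_connection_push holomorphic_bundle_split)
        (auto simp: is_splitting_def effective_def)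
    then obtain A' B' C' E' where W': "rational_form D (split_conn \<tau> N) A' B' C' E'"
      using split_bundle_connection_rational[OF _ _ D] by (metis push_def connection.select_convs(1) split_conn_def)
    obtain u v s where uvs: "u \<noteq> 0" "v \<noteq> 0" "\<And>x. form_aff (split_conn \<tau> N) x =
       gauge (\<lambda>z. mat2 u 0 (poly s z) v) (form_aff (split_conn \<sigma> N)) x"
      using change_of_splitting[OF \<sigma> \<tau>] by blast
    have "B' = smult (u / v) B" by (rule rational_form_change(1)[OF D(1) uvs(1,2) W W' uvs(3)])
    with W' uvs(1,2) show ?thesis by (metis divide_eq_0_iff)
  qed
  obtain \<tau> where \<tau>: "is_splitting N \<tau>" "\<not> L_invariant D (split_conn \<tau> N)"
    using N by (auto simp: set_U_def)
  show B: "B \<noteq> 0"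
  proof
    assume "B = 0"
    then have "L_invariant D (split_conn \<tau> N)"
      using other[OF \<tau>(1)] by (auto simp: L_invariant_def rational_form_def)
    then show False using \<tau>(2) by contradiction
  qed
  define \<sigma>\<^sub>0 where "\<sigma>\<^sub>0 = (SOME \<sigma>. is_splitting N \<sigma>)"
  have "is_splitting N \<sigma>\<^sub>0" unfolding \<sigma>\<^sub>0_def using \<sigma> by (rule someI)
  then obtain A' \<kappa> C' E' where W': "\<kappa> \<noteq> 0" "rational_form D (split_conn \<sigma>\<^sub>0 N) A' (smult \<kappa> B) C' E'"
    using other by blast
  have "App D N (Aff a) = zorder (\<lambda>z. form_aff (split_conn \<sigma>\<^sub>0 N) z $ 1 $ 2) a + D (Aff a)"
    by (simp add: App_def Let_def \<sigma>\<^sub>0_def local_form_def)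
  also have "\<dots> = int (order a (smult \<kappa> B))"
    using W' B by (intro zorder_rational D(1)) (auto simp: rational_form_def)
  also have "order a (smult \<kappa> B) = order a B" using W'(1) by (rule order_smult)
  finally show "App D N (Aff a) = int (order a B)" .
qed

section \<open>Normalization on \<open>E\<^sub>0\<close>\<close>

text \<open>
  In the affine chart \<open>\<phi>\<close> is multiplication by \<open>P b = B\<close>, which turns the upper right entry
  \<open>B/P\<close> into \<open>1/P\<close> and contributes the logarithmic derivative of \<open>B\<close> to the lower right one.
\<close>

lemma phi_transf_rational_form:
  assumes D: "effective D" and W: "rational_form D T A B C E"
    and x: "Aff x \<notin> div_support D" "poly B x \<noteq> 0"
  shows "form_aff (push (phi_transf D T) H T) x =
    mat2 (poly A x / div_poly D x) (1 / div_poly D x) (poly C x * poly B x / div_poly D x)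
         (poly E x / div_poly D x - poly (pderiv B) x / poly B x)"
proof -
  let ?P = "div_poly D"
  have P: "?P z \<noteq> 0" if "Aff z \<notin> div_support D" for z
    using D that by (rule div_poly_nonzero)
  have ev: "\<forall>\<^sub>F z in nhds x. fst (phi_transf D T) z = mat2 1 0 0 (poly B z)"
    using eventually_nhds_not_affine_support[OF D x(1)]
    by eventually_elim (use W P in \<open>simp add: phi_transf_def diag2_eq_mat2 rational_form_def\<close>)
  have "gauge (fst (phi_transf D T)) (form_aff T) x = mat2
      (poly A x / ?P x - poly B x / ?P x * 0 / poly B x - 0 / 1) (1 * (poly B x / ?P x) / poly B x)
      ((0 * (poly A x / ?P x) + poly B x * (poly C x / ?P x)) / 1
        - (0 * (poly B x / ?P x) + poly B x * (poly E x / ?P x)) * 0 / (1 * poly B x)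
        - 0 / 1 + poly (pderiv B) x * 0 / (1 * poly B x))
      (0 * (poly B x / ?P x) / poly B x + poly E x / ?P x - poly (pderiv B) x / poly B x)"
    by (rule gauge_lower_triangular[OF ev]) (use W x in \<open>auto simp: rational_form_def intro!: poly_DERIV\<close>)
  then show ?thesis using x by (simp add: push_def mult.commute)
qed

text \<open>
  The automorphism is kept general, because existence and uniqueness of the normal form are both
  read off from this matrix.
\<close>

lemma E0_connection_rational_form:
  assumes D: "effective D" and W: "rational_form D (split_conn \<sigma> N) A B C E"
    and \<psi>: "\<And>z. fst \<psi> z = mat2 u 0 (poly g z) v" "u \<noteq> 0" "v \<noteq> 0"
    and x: "Aff x \<notin> div_support D" "poly B x \<noteq> 0"
  shows "form_aff (E0_connection D \<sigma> \<psi> N) x = mat2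
    ((poly A x - poly g x / v) / div_poly D x) (u / (v * div_poly D x))
    ((poly g x * poly A x + v * poly C x * poly B x) / (u * div_poly D x)
      - (poly g x / div_poly D x + v * (poly E x / div_poly D x - poly (pderiv B) x / poly B x))
          * poly g x / (u * v) - poly (pderiv g) x / u)
    ((poly g x / v + poly E x) / div_poly D x - poly (pderiv B) x / poly B x)"
proof -
  let ?P = "div_poly D" and ?b = "poly (pderiv B) x / poly B x"
  let ?T = "push (phi_transf D (split_conn \<sigma> N)) (E0_bundle D) (split_conn \<sigma> N)"
  have P: "?P x \<noteq> 0" using D x(1) by (rule div_poly_nonzero)
  have "gauge (fst \<psi>) (form_aff ?T) x = mat2
      (poly A x / ?P x - 1 / ?P x * poly g x / v - 0 / u) (u * (1 / ?P x) / v)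
      ((poly g x * (poly A x / ?P x) + v * (poly C x * poly B x / ?P x)) / u
        - (poly g x * (1 / ?P x) + v * (poly E x / ?P x - ?b)) * poly g x / (u * v)
        - poly (pderiv g) x / u + 0 * poly g x / (u * v))
      (poly g x * (1 / ?P x) / v + (poly E x / ?P x - ?b) - 0 / v)"
    by (rule gauge_lower_triangular)
       (use \<psi> phi_transf_rational_form[OF D W x] in \<open>auto intro!: poly_DERIV\<close>)
  then show ?thesis
    using P \<psi>(2,3) by (simp add: E0_connection_def Let_def push_def) (simp add: cmat_eq_iff field_simps)
qed

text \<open>
  The upper left entry \<open>A/P\<close> is killed by the unipotent automorphism with off-diagonal entry
  \<open>A\<close>. It is a global automorphism of \<open>O \<oplus> O(n - 2)\<close> precisely because \<open>A\<close> has degree at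
  most \<open>n - 2\<close>.
\<close>

lemma E0_connection_normal_form_exists:
  assumes D: "effective D" "2 \<le> div_degree D" and W: "rational_form D (split_conn \<sigma> N) A B C E"
    and A: "deg_le A (div_degree D - 2)"
  shows "\<exists>\<psi>. bundle_iso (E0_bundle D) (E0_bundle D) \<psi> \<and>
    (\<forall>x. Aff x \<notin> div_support D \<and> poly B x \<noteq> 0 \<longrightarrow> form_aff (E0_connection D \<sigma> \<psi> N) x =
        normal_matrix (div_poly D) (normal_c D A B C E) (normal_d D A B E) x)"
proof -
  obtain k where k: "div_degree D - 2 = int k"
    using D(2) nonneg_int_cases[of "div_degree D - 2"] by auto
  obtain \<psi> where \<psi>: "bundle_iso (E0_bundle D) (E0_bundle D) \<psi>" "\<And>x. fst \<psi> x = mat2 1 0 (poly A x) 1"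
    using split_bundle_unipotent_automorphism[of A k] A by (auto simp: E0_bundle_def k)
  have "form_aff (E0_connection D \<sigma> \<psi> N) x =
      normal_matrix (div_poly D) (normal_c D A B C E) (normal_d D A B E) x"
    if x: "Aff x \<notin> div_support D" "poly B x \<noteq> 0" for x
    unfolding E0_connection_rational_form[OF D(1) W \<psi>(2) one_neq_zero one_neq_zero x] normal_matrix_def
      normal_c_def normal_d_def mat2_def[symmetric]
    using x(2) div_poly_nonzero[OF D(1) x(1)] by (simp add: cmat_eq_iff divide_simps) (simp add: algebra_simps)
  with \<psi>(1) show ?thesis by blast
qed

text \<open>
  For \<open>n \<ge> 3\<close> the automorphisms of \<open>E\<^sub>0\<close> are lower triangular with constant diagonal \<open>u, v\<close>. The
  upper right entry forces \<open>u = v\<close>, the upper left one forces the remaining entry to be \<open>v A\<close>, and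
  scalars act trivially.
\<close>

lemma E0_connection_normal_form_unique:
  assumes D: "effective D" "3 \<le> div_degree D" and W: "rational_form D (split_conn \<sigma> N) A B C E"
    and B: "B \<noteq> 0"
    and \<psi>: "bundle_iso (E0_bundle D) (E0_bundle D) \<psi>"
    and nf: "\<And>x. Aff x \<notin> div_support D \<Longrightarrow> poly B x \<noteq> 0 \<Longrightarrow>
        form_aff (E0_connection D \<sigma> \<psi> N) x = normal_matrix (div_poly D) c d x"
    and x: "Aff x \<notin> div_support D" "poly B x \<noteq> 0"
  shows "c x = normal_c D A B C E x" "d x = normal_d D A B E x"
proof -
  obtain u v g where \<psi>_eq: "u \<noteq> 0" "v \<noteq> 0" "\<And>x. fst \<psi> x = mat2 u 0 (poly g x) v"
    by (rule split_bundle_automorphism[of "div_degree D - 2" \<psi>]) (use D(2) \<psi> in \<open>auto simp: E0_bundle_def\<close>)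
  note form = E0_connection_rational_form[OF D(1) W \<psi>_eq(3,1,2)]
  have P: "div_poly D z \<noteq> 0" if "Aff z \<notin> div_support D" for z
    using D(1) that by (rule div_poly_nonzero)
  have entries: "poly A z = poly g z / v" "u = v" if "Aff z \<notin> div_support D" "poly B z \<noteq> 0" for z
    using nf[OF that] P[OF that(1)] \<psi>_eq(1,2)
    unfolding form[OF that] normal_matrix_def mat2_def[symmetric]
    by (simp_all add: cmat_eq_iff) (simp add: divide_simps)
  have uv: "u = v" using entries(2) x by blast
  have "g = smult v A"
  proof (rule poly_eq_off_finite)
    show "finite (affine_support D \<union> {z. poly B z = 0})"
      using finite_affine_support[OF D(1)] poly_roots_finite[OF B] by blast
    show "poly g z = poly (smult v A) z" if "z \<notin> affine_support D \<union> {z. poly B z = 0}" for z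
      using entries(1)[of z] that \<psi>_eq(2) by simp
  qed
  then have g: "poly g x = v * poly A x" "poly (pderiv g) x = v * poly (pderiv A) x"
    by (simp_all add: pderiv_smult)
  have cd: "c x = form_aff (E0_connection D \<sigma> \<psi> N) x $ 2 $ 1" "d x = form_aff (E0_connection D \<sigma> \<psi> N) x $ 2 $ 2"
    unfolding nf[OF x] normal_matrix_def mat2_def[symmetric] by simp_all
  show "c x = normal_c D A B C E x" "d x = normal_d D A B E x"
    unfolding cd form[OF x] mat2_nth normal_c_def normal_d_def g uv
    using P[OF x(1)] x(2) \<psi>_eq(2) by (simp_all add: divide_simps) (simp_all add: algebra_simps)
qed

section \<open>Partial fraction expansions of the normal form\<close>

lemma simple_roots_log_derivative:
  fixes B :: "complex poly"
  assumes J: "finite J" "inj_on q J" and B: "B \<noteq> 0"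
    and ord: "\<And>a. order a B = (if a \<in> q ` J then 1 else 0)"
  shows "poly B x = 0 \<longleftrightarrow> x \<in> q ` J"
    and "x \<notin> q ` J \<Longrightarrow> poly (pderiv B) x / poly B x = (\<Sum>j\<in>J. 1 / (x - q j))"
proof -
  have roots: "poly B z = 0 \<longleftrightarrow> z \<in> q ` J" for z
    using B ord[of z] by (simp add: order_root)
  show "poly B x = 0 \<longleftrightarrow> x \<in> q ` J" by (rule roots)
  assume x: "x \<notin> q ` J"
  have "B = smult (lead_coeff B) (\<Prod>z | poly B z = 0. [:- z, 1:] ^ order z B)"
    by (rule complex_poly_decompose[symmetric])
  also have "(\<Prod>z | poly B z = 0. [:- z, 1:] ^ order z B) = (\<Prod>z\<in>q ` J. [:- z, 1:])"
    using roots ord by (intro prod.cong) auto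
  also have "\<dots> = (\<Prod>j\<in>J. [:- q j, 1:])"
    using J(2) by (simp add: prod.reindex)
  finally have B_eq: "B = smult (lead_coeff B) (\<Prod>j\<in>J. [:- q j, 1:])" .
  have Px: "poly (\<Prod>j\<in>J. [:- q j, 1:]) x = (\<Prod>j\<in>J. x - q j)"
    by (simp add: poly_prod)
  have nz: "x - q j \<noteq> 0" if "j \<in> J" for j using x that by auto
  have "poly (pderiv (\<Prod>j\<in>J. [:- q j, 1:])) x = (\<Sum>j\<in>J. \<Prod>i\<in>J - {j}. x - q i)"
    by (simp add: pderiv_prod poly_sum poly_prod pderiv_pCons)
  also have "\<dots> = (\<Sum>j\<in>J. (\<Prod>i\<in>J. x - q i) * (1 / (x - q j)))"
    using J(1) nz by (intro sum.cong) (auto simp: prod.remove)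
  also have "\<dots> = (\<Prod>i\<in>J. x - q i) * (\<Sum>j\<in>J. 1 / (x - q j))"
    by (rule sum_distrib_left[symmetric])
  finally have D: "poly (pderiv (\<Prod>j\<in>J. [:- q j, 1:])) x =
      (\<Prod>i\<in>J. x - q i) * (\<Sum>j\<in>J. 1 / (x - q j))" .
  have "(\<Prod>i\<in>J. x - q i) \<noteq> 0" using J(1) nz by simp
  moreover have "lead_coeff B \<noteq> 0" using B by simp
  ultimately show "poly (pderiv B) x / poly B x = (\<Sum>j\<in>J. 1 / (x - q j))"
    by (subst (1 2) B_eq) (simp add: pderiv_smult D Px)
qed

lemma deg_le_synthetic_div: "deg_le p k \<Longrightarrow> deg_le (synthetic_div p c) (k - 1)"
  by (cases "degree p = 0") (auto simp: deg_le_def degree_synthetic_div synthetic_div_eq_0_iff)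

text \<open>
  The term \<open>(B C - A E)/P\<close> gives the poles at the \<open>t i\<close>, and \<open>A B'/B\<close>, the sum of
  \<open>A/(x - q j)\<close>, gives the poles at the \<open>q j\<close> with residues \<open>\<zeta> j = A (q j)\<close>. The polynomial part
  has degree at most \<open>(2n - 4) - (n - l) = (n - 3) + (l - 1)\<close>, and is cut at degree \<open>n - 3\<close>.
\<close>

lemma normal_c_expansion:
  fixes t q :: "nat \<Rightarrow> complex" and m :: "nat \<Rightarrow> nat"
  assumes fin: "finite I" "finite J" and t: "inj_on t I"
    and deg: "deg_le A (int n - 2)" "deg_le B (int n - 3)" "deg_le C (int n - 1)" "deg_le E (int n - 2)"
    and n: "3 \<le> n" "int n = int (\<Sum>i\<in>I. m i) + int l" "1 \<le> l"
    and P: "\<And>x. div_poly D x = (\<Prod>i\<in>I. (x - t i) ^ m i)"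
    and B: "\<And>x. x \<notin> q ` J \<Longrightarrow> poly (pderiv B) x / poly B x = (\<Sum>j\<in>J. 1 / (x - q j))"
  obtains Cp C_inf Ct where "\<And>i. i \<in> I \<Longrightarrow> deg_le (Cp i) (int (m i) - 1)"
    "deg_le C_inf (int l - 1)" "deg_le Ct (int n - 4)"
    "\<And>x. x \<notin> t ` I \<union> q ` J \<Longrightarrow> normal_c D A B C E x =
       (\<Sum>i\<in>I. poly (Cp i) x / (x - t i) ^ m i) + (\<Sum>j\<in>J. poly A (q j) / (x - q j))
         + poly Ct x + x ^ (n - 3) * poly C_inf x"
proof -
  let ?k = "int n - 4 + int l"
  have "deg_le (B * C) ((int n - 3) + (int n - 1))" "deg_le (A * E) ((int n - 2) + (int n - 2))"
    using deg by (intro deg_le_mult; simp)+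
  then have "deg_le (B * C - A * E) (int (\<Sum>i\<in>I. m i) + ?k)"
    using n(2) by (intro deg_le_diff) (simp_all add: algebra_simps)
  from partial_fractions[OF fin(1) t this] n obtain Cp Q where
    Cp: "\<And>i. i \<in> I \<Longrightarrow> deg_le (Cp i) (int (m i) - 1)" "deg_le Q ?k"
      "\<And>x. x \<notin> t ` I \<Longrightarrow> poly (B * C - A * E) x / div_poly D x =
         (\<Sum>i\<in>I. poly (Cp i) x / (x - t i) ^ m i) + poly Q x"
    unfolding P by auto
  define R where "R = Q + (\<Sum>j\<in>J. synthetic_div A (q j)) - pderiv A"
  have "deg_le R ?k"
    unfolding R_def
  proof (intro deg_le_diff deg_le_add deg_le_sum Cp(2))
    show "deg_le (synthetic_div A (q j)) ?k" for j
      using deg_le_synthetic_div[OF deg(1)] by (rule deg_le_mono) (use n in simp)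
    show "deg_le (pderiv A) ?k"
      using deg_le_pderiv[OF deg(1)] by (rule deg_le_mono) (use n in simp)
  qed
  then obtain Ct C_inf where R: "deg_le Ct (int (n - 3) - 1)" "deg_le C_inf (?k - int (n - 3))"
    "R = Ct + monom 1 (n - 3) * C_inf"
    by (rule deg_le_split)
  show ?thesis
  proof (rule that[OF Cp(1)])
    show "deg_le C_inf (int l - 1)" "deg_le Ct (int n - 4)"
      using R(1,2) n(1) by (simp_all add: of_nat_diff)
    fix x assume x: "x \<notin> t ` I \<union> q ` J"
    have "poly A x / (x - q j) = poly A (q j) / (x - q j) + poly (synthetic_div A (q j)) x"
      if "j \<in> J" for j
    proof -
      have "poly A x = (x - q j) * poly (synthetic_div A (q j)) x + poly A (q j)"
        by (subst synthetic_div_correct'[of "q j" A, symmetric]) (simp add: algebra_simps)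
      moreover have "x - q j \<noteq> 0" using x that by auto
      ultimately show ?thesis by (simp add: add_divide_distrib)
    qed
    then have "poly A x * (poly (pderiv B) x / poly B x) =
        (\<Sum>j\<in>J. poly A (q j) / (x - q j)) + (\<Sum>j\<in>J. poly (synthetic_div A (q j)) x)"
      using B[of x] x by (simp add: sum_distrib_left sum.distrib[symmetric])
    moreover have "poly R x = poly Ct x + x ^ (n - 3) * poly C_inf x"
      by (simp add: R(3) poly_monom)
    ultimately show "normal_c D A B C E x =
       (\<Sum>i\<in>I. poly (Cp i) x / (x - t i) ^ m i) + (\<Sum>j\<in>J. poly A (q j) / (x - q j))
         + poly Ct x + x ^ (n - 3) * poly C_inf x"
      using Cp(3)[of x] x by (simp add: normal_c_def R_def poly_sum algebra_simps)
  qed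
qed

lemma normal_d_expansion:
  fixes t q :: "nat \<Rightarrow> complex" and m :: "nat \<Rightarrow> nat"
  assumes fin: "finite I" and t: "inj_on t I"
    and deg: "deg_le A (int n - 2)" "deg_le E (int n - 2)"
    and n: "int n = int (\<Sum>i\<in>I. m i) + int l" "1 \<le> l"
    and P: "\<And>x. div_poly D x = (\<Prod>i\<in>I. (x - t i) ^ m i)"
    and B: "\<And>x. x \<notin> q ` J \<Longrightarrow> poly (pderiv B) x / poly B x = (\<Sum>j\<in>J. 1 / (x - q j))"
  obtains Dp D_inf where "\<And>i. i \<in> I \<Longrightarrow> deg_le (Dp i) (int (m i) - 1)"
    "deg_le D_inf (int l - 2)"
    "\<And>x. x \<notin> t ` I \<union> q ` J \<Longrightarrow> normal_d D A B E x =
       (\<Sum>i\<in>I. poly (Dp i) x / (x - t i) ^ m i) + (\<Sum>j\<in>J. - 1 / (x - q j)) + poly D_inf x"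
proof -
  have "deg_le (A + E) (int (\<Sum>i\<in>I. m i) + (int l - 2))"
    using deg n(1) by (intro deg_le_add) (simp_all add: algebra_simps)
  from partial_fractions[OF fin t this] n obtain Dp Q where
    Dp: "\<And>i. i \<in> I \<Longrightarrow> deg_le (Dp i) (int (m i) - 1)" "deg_le Q (int l - 2)"
      "\<And>x. x \<notin> t ` I \<Longrightarrow> poly (A + E) x / div_poly D x =
         (\<Sum>i\<in>I. poly (Dp i) x / (x - t i) ^ m i) + poly Q x"
    unfolding P by auto
  show ?thesis
  proof (rule that[OF Dp(1,2)])
    fix x assume x: "x \<notin> t ` I \<union> q ` J"
    then show "normal_d D A B E x =
       (\<Sum>i\<in>I. poly (Dp i) x / (x - t i) ^ m i) + (\<Sum>j\<in>J. - 1 / (x - q j)) + poly Q x"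
      using Dp(3)[of x] B[of x] by (simp add: normal_d_def sum_negf)
  qed
qed

section \<open>The normal form\<close>

theorem proposition15:
  fixes \<nu> n n_inf :: nat
    and m :: "nat \<Rightarrow> nat"
    and t q :: "nat \<Rightarrow> complex"
    and D :: divisor
    and P :: "complex \<Rightarrow> complex"
    and \<Lambda> :: formal_data
    and N :: connection
  assumes "inj_on t {1..\<nu>}"
    and "\<And>i. i \<in> {1..\<nu>} \<Longrightarrow> 1 \<le> m i"
    and "1 \<le> n_inf"
    and "D = (\<lambda>p. (\<Sum>i=1..\<nu>. int (m i) * pt (Aff (t i)) p) + int n_inf * pt Infty p)"
    and "int n = div_degree D"
    and "P = (\<lambda>x. \<Prod>i=1..\<nu>. (x - t i) ^ m i)"
    and "admissible_data D \<Lambda>"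
    and "N \<in> set_V D \<Lambda>"
    and "inj_on q {1..n-3}"
    and "q ` {1..n-3} \<inter> t ` {1..\<nu>} = {}"
    and "App D N = (\<lambda>p. \<Sum>j=1..n-3. pt (Aff (q j)) p)"
  shows "\<exists>c\<^sub>0 d\<^sub>0.
    (\<forall>\<sigma>. is_splitting N \<sigma> \<longrightarrow>
       (\<exists>\<psi>. bundle_iso (E0_bundle D) (E0_bundle D) \<psi> \<and>
          (\<forall>x. x \<notin> t ` {1..\<nu>} \<union> q ` {1..n-3} \<longrightarrow>
             form_aff (E0_connection D \<sigma> \<psi> N) x = normal_matrix P c\<^sub>0 d\<^sub>0 x))) \<and>
    (\<forall>\<sigma> \<psi> c d. is_splitting N \<sigma> \<and> bundle_iso (E0_bundle D) (E0_bundle D) \<psi> \<and>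
       (\<forall>x. x \<notin> t ` {1..\<nu>} \<union> q ` {1..n-3} \<longrightarrow>
          form_aff (E0_connection D \<sigma> \<psi> N) x = normal_matrix P c d x) \<longrightarrow>
       (\<forall>x. x \<notin> t ` {1..\<nu>} \<union> q ` {1..n-3} \<longrightarrow> c x = c\<^sub>0 x \<and> d x = d\<^sub>0 x)) \<and>
    (\<exists>(\<zeta> :: nat \<Rightarrow> complex) (C :: nat \<Rightarrow> complex poly) (Dp :: nat \<Rightarrow> complex poly)
        (C_inf :: complex poly) (D_inf :: complex poly) (Ct :: complex poly).
       (\<forall>i\<in>{1..\<nu>}. deg_le (C i) (int (m i) - 1) \<and> deg_le (Dp i) (int (m i) - 1)) \<and>
       deg_le C_inf (int n_inf - 1) \<and> deg_le D_inf (int n_inf - 2) \<and> deg_le Ct (int n - 4) \<and>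
       (\<forall>x. x \<notin> t ` {1..\<nu>} \<union> q ` {1..n-3} \<longrightarrow>
          c\<^sub>0 x = (\<Sum>i=1..\<nu>. poly (C i) x / (x - t i) ^ m i) + (\<Sum>j=1..n-3. \<zeta> j / (x - q j))
                 + poly Ct x + x ^ (n - 3) * poly C_inf x \<and>
          d\<^sub>0 x = (\<Sum>i=1..\<nu>. poly (Dp i) x / (x - t i) ^ m i) + (\<Sum>j=1..n-3. - 1 / (x - q j))
                 + poly D_inf x))"
proof -
  note t_inj = assms(1) and m_pos = assms(2) and n_inf = assms(3) and D_eq = assms(4)
    and n_eq = assms(5) and P_eq = assms(6) and N = assms(8) and q_inj = assms(9) and App = assms(11)
  let ?I = "{1..\<nu>}" and ?J = "{1..n-3}"
  have D_inf: "D Infty = int n_inf" by (simp add: D_eq pt_def)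
  have D_t: "D (Aff (t i)) = int (m i)" if "i \<in> ?I" for i
  proof -
    have "D (Aff (t i)) = (\<Sum>j\<in>?I. int (m j) * pt (Aff (t j)) (Aff (t i)))"
      by (subst D_eq) (simp add: pt_def[of Infty])
    also have "\<dots> = (\<Sum>j\<in>?I. if j = i then int (m j) else 0)"
      using that by (intro sum.cong refl) (auto simp: pt_def inj_on_eq_iff[OF t_inj])
    also have "\<dots> = int (m i)" using that by (subst sum.delta) auto
    finally show ?thesis .
  qed
  have D_off: "D (Aff a) = 0" if "a \<notin> t ` ?I" for a
    using that by (auto simp: D_eq pt_def intro!: sum.neutral)
  have aff: "affine_support D = t ` ?I"
  proof (intro set_eqI iffI)
    fix a assume "a \<in> affine_support D"
    then show "a \<in> t ` ?I" using D_off[of a] by (auto simp: div_support_def)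
  next
    fix a assume "a \<in> t ` ?I"
    then obtain i where "i \<in> ?I" "a = t i" by blast
    then show "a \<in> affine_support D" using D_t[of i] m_pos[of i] by (simp add: div_support_def)
  qed
  have supp: "Aff x \<in> div_support D \<longleftrightarrow> x \<in> t ` ?I" for x using aff by auto
  have eff: "effective D" unfolding effective_def
  proof
    show "finite (div_support D)"
      using div_support_subset by (rule finite_subset) (simp add: aff)
    show "\<forall>p. 0 \<le> D p" unfolding D_eq pt_def by (auto intro!: add_nonneg_nonneg sum_nonneg)
  qed
  have D1: "1 \<le> D Infty" using n_inf D_inf by simp
  have P: "div_poly D x = (\<Prod>i\<in>?I. (x - t i) ^ m i)" for x
    unfolding div_poly_def aff using t_inj by (simp add: prod.reindex D_t)
  then have P': "P = div_poly D" by (simp add: P_eq fun_eq_iff)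
  have n_sum: "int n = int (\<Sum>i\<in>?I. m i) + int n_inf"
    unfolding n_eq div_degree_eq[OF eff] aff D_inf using t_inj by (simp add: sum.reindex D_t)
  have U: "N \<in> set_U D \<Lambda>" using N by (simp add: set_V_def)
  have mero: "meromorphic_connection D N" using U by (simp add: set_U_def \<Lambda>_connection_def)

  have form: "\<exists>A B C E. rational_form D (split_conn \<sigma> N) A B C E \<and> deg_le A (int n - 2) \<and>
      deg_le B (int n - 3) \<and> deg_le C (int n - 1) \<and> deg_le E (int n - 2)"
    if \<sigma>: "is_splitting N \<sigma>" for \<sigma>
  proof -
    have "meromorphic_connection D (split_conn \<sigma> N)" unfolding split_conn_def
      using mero \<sigma> eff by (intro meromorphic_connection_push holomorphic_bundle_split)
        (auto simp: is_splitting_def effective_def)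
    moreover have "cocycle (split_conn \<sigma> N) = split_bundle 1" by (simp add: split_conn_def push_def)
    ultimately obtain A B C E where "rational_form D (split_conn \<sigma> N) A B C E"
        "deg_le A (div_degree D - 2)" "deg_le B (div_degree D - 2 - 1)"
        "deg_le C (div_degree D - 2 + 1)" "deg_le E (div_degree D - 2)"
      using split_bundle_connection_rational[OF _ _ eff D1] by blast
    then show ?thesis unfolding n_eq[symmetric] by (auto simp: algebra_simps)
  qed
  have roots: "B \<noteq> 0" "poly B x = 0 \<longleftrightarrow> x \<in> q ` ?J"
    "x \<notin> q ` ?J \<Longrightarrow> poly (pderiv B) x / poly B x = (\<Sum>j\<in>?J. 1 / (x - q j))"
    if "is_splitting N \<sigma>" "rational_form D (split_conn \<sigma> N) A B C E" for \<sigma> A B C E x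
  proof -
    note B = App_eq_order[OF U eff D1 that]
    have "int (order a B) = int (if a \<in> q ` ?J then 1 else 0)" for a
    proof (cases "a \<in> q ` ?J")
      case True
      then obtain i where i: "i \<in> ?J" "a = q i" by blast
      have "int (order a B) = (\<Sum>j\<in>?J. pt (Aff (q j)) (Aff a))"
        using B(2)[of a] fun_cong[OF App, of "Aff a"] by linarith
      also have "\<dots> = (\<Sum>j\<in>?J. if j = i then 1 else 0)"
        using i by (intro sum.cong refl) (auto simp: pt_def inj_on_eq_iff[OF q_inj])
      also have "\<dots> = 1" using i(1) by (subst sum.delta) auto
      finally show ?thesis using True by simp
    next
      case False
      then have "(\<Sum>j\<in>?J. pt (Aff (q j)) (Aff a)) = 0"
        by (intro sum.neutral) (auto simp: pt_def)
      then show ?thesis using False B(2)[of a] fun_cong[OF App, of "Aff a"] by simp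
    qed
    then have ord: "order a B = (if a \<in> q ` ?J then 1 else 0)" for a
      using of_nat_eq_iff by blast
    show "B \<noteq> 0" by (rule B(1))
    show "poly B x = 0 \<longleftrightarrow> x \<in> q ` ?J"
      by (rule simple_roots_log_derivative(1)[OF _ q_inj B(1) ord]) simp
    show "x \<notin> q ` ?J \<Longrightarrow> poly (pderiv B) x / poly B x = (\<Sum>j\<in>?J. 1 / (x - q j))"
      by (rule simple_roots_log_derivative(2)[OF _ q_inj B(1) ord]) simp
  qed

  obtain \<sigma> where \<sigma>: "is_splitting N \<sigma>" using U by (auto simp: set_U_def)
  obtain A B C E where W: "rational_form D (split_conn \<sigma> N) A B C E"
    and deg: "deg_le A (int n - 2)" "deg_le B (int n - 3)" "deg_le C (int n - 1)" "deg_le E (int n - 2)"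
    using form[OF \<sigma>] by blast
  note B = roots[OF \<sigma> W]
  have n3: "3 \<le> n" using deg(2) B(1) by (auto simp: deg_le_def)
  \<comment> \<open>Any splitting gives the same two functions, so one can be fixed once and for all.\<close>
  have independent: "normal_c D A' B' C' E' x = normal_c D A B C E x \<and> normal_d D A' B' E' x = normal_d D A B E x"
    if \<tau>: "is_splitting N \<tau>" "rational_form D (split_conn \<tau> N) A' B' C' E'" "x \<notin> t ` ?I \<union> q ` ?J"
    for \<tau> A' B' C' E' x
  proof -
    obtain u v s where uvs: "u \<noteq> 0" "v \<noteq> 0" "\<And>x. form_aff (split_conn \<tau> N) x =
       gauge (\<lambda>z. mat2 u 0 (poly s z) v) (form_aff (split_conn \<sigma> N)) x"
      using change_of_splitting[OF \<sigma> \<tau>(1)] by blast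
    show ?thesis
      using rational_form_change(2,3)[OF eff uvs(1,2) W \<tau>(2) uvs(3), of x] \<tau>(3) B(2) supp by auto
  qed
  obtain Cp C_inf Ct where c: "\<And>i. i \<in> ?I \<Longrightarrow> deg_le (Cp i) (int (m i) - 1)"
    "deg_le C_inf (int n_inf - 1)" "deg_le Ct (int n - 4)"
    "\<And>x. x \<notin> t ` ?I \<union> q ` ?J \<Longrightarrow> normal_c D A B C E x =
       (\<Sum>i\<in>?I. poly (Cp i) x / (x - t i) ^ m i) + (\<Sum>j\<in>?J. poly A (q j) / (x - q j))
         + poly Ct x + x ^ (n - 3) * poly C_inf x"
    by (rule normal_c_expansion[of ?I ?J t A n B C E m n_inf D q])
       (use t_inj deg n3 n_sum n_inf P B(3) in auto)
  obtain Dp D_infp where d: "\<And>i. i \<in> ?I \<Longrightarrow> deg_le (Dp i) (int (m i) - 1)"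
    "deg_le D_infp (int n_inf - 2)"
    "\<And>x. x \<notin> t ` ?I \<union> q ` ?J \<Longrightarrow> normal_d D A B E x =
       (\<Sum>i\<in>?I. poly (Dp i) x / (x - t i) ^ m i) + (\<Sum>j\<in>?J. - 1 / (x - q j)) + poly D_infp x"
    by (rule normal_d_expansion[of ?I t A n E m n_inf D q ?J B])
       (use t_inj deg n_sum n_inf P B(3) in auto)
  show ?thesis
  proof (rule exI[of _ "normal_c D A B C E"], rule exI[of _ "normal_d D A B E"], intro conjI allI impI)
    fix \<tau> assume \<tau>: "is_splitting N \<tau>"
    obtain A' B' C' E' where W': "rational_form D (split_conn \<tau> N) A' B' C' E'" "deg_le A' (int n - 2)"
      using form[OF \<tau>] by blast
    obtain \<psi> where \<psi>: "bundle_iso (E0_bundle D) (E0_bundle D) \<psi>"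
      "\<And>x. Aff x \<notin> div_support D \<Longrightarrow> poly B' x \<noteq> 0 \<Longrightarrow> form_aff (E0_connection D \<tau> \<psi> N) x =
        normal_matrix (div_poly D) (normal_c D A' B' C' E') (normal_d D A' B' E') x"
      using E0_connection_normal_form_exists[OF eff _ W'(1)] W'(2) n3 unfolding n_eq[symmetric] by auto
    show "\<exists>\<psi>. bundle_iso (E0_bundle D) (E0_bundle D) \<psi> \<and>
          (\<forall>x. x \<notin> t ` ?I \<union> q ` ?J \<longrightarrow>
             form_aff (E0_connection D \<tau> \<psi> N) x = normal_matrix P (normal_c D A B C E) (normal_d D A B E) x)"
    proof (intro exI[of _ \<psi>] conjI allI impI \<psi>(1))
      fix x assume x: "x \<notin> t ` ?I \<union> q ` ?J"
      then show "form_aff (E0_connection D \<tau> \<psi> N) x = normal_matrix P (normal_c D A B C E) (normal_d D A B E) x"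
        using \<psi>(2)[of x] independent[OF \<tau> W'(1) x] roots(2)[OF \<tau> W'(1), of x] supp[of x]
        by (simp add: P' normal_matrix_def)
    qed
  next
    fix \<tau> \<psi> c d x
    assume *: "is_splitting N \<tau> \<and> bundle_iso (E0_bundle D) (E0_bundle D) \<psi> \<and>
       (\<forall>x. x \<notin> t ` ?I \<union> q ` ?J \<longrightarrow> form_aff (E0_connection D \<tau> \<psi> N) x = normal_matrix P c d x)"
      and x: "x \<notin> t ` ?I \<union> q ` ?J"
    then have \<tau>: "is_splitting N \<tau>" by blast
    obtain A' B' C' E' where W': "rational_form D (split_conn \<tau> N) A' B' C' E'"
      using form[OF \<tau>] by blast
    have good: "Aff z \<notin> div_support D \<and> poly B' z \<noteq> 0 \<longleftrightarrow> z \<notin> t ` ?I \<union> q ` ?J" for z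
      using roots(2)[OF \<tau> W'] supp by auto
    have nf: "form_aff (E0_connection D \<tau> \<psi> N) z = normal_matrix (div_poly D) c d z"
      if "Aff z \<notin> div_support D" "poly B' z \<noteq> 0" for z
      using * that good[of z] by (simp add: P')
    have "c x = normal_c D A' B' C' E' x \<and> d x = normal_d D A' B' E' x"
      using E0_connection_normal_form_unique[OF eff _ W' roots(1)[OF \<tau> W'] _ nf] * x n3 n_eq good[of x]
      by simp
    then show "c x = normal_c D A B C E x" "d x = normal_d D A B E x"
      using independent[OF \<tau> W' x] by auto
  next
    show "\<exists>(\<zeta> :: nat \<Rightarrow> complex) (C' :: nat \<Rightarrow> complex poly) (Dp :: nat \<Rightarrow> complex poly)
        (C_inf :: complex poly) (D_inf :: complex poly) (Ct :: complex poly).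
       (\<forall>i\<in>?I. deg_le (C' i) (int (m i) - 1) \<and> deg_le (Dp i) (int (m i) - 1)) \<and>
       deg_le C_inf (int n_inf - 1) \<and> deg_le D_inf (int n_inf - 2) \<and> deg_le Ct (int n - 4) \<and>
       (\<forall>x. x \<notin> t ` ?I \<union> q ` ?J \<longrightarrow>
          normal_c D A B C E x = (\<Sum>i=1..\<nu>. poly (C' i) x / (x - t i) ^ m i) + (\<Sum>j=1..n-3. \<zeta> j / (x - q j))
                 + poly Ct x + x ^ (n - 3) * poly C_inf x \<and>
          normal_d D A B E x = (\<Sum>i=1..\<nu>. poly (Dp i) x / (x - t i) ^ m i) + (\<Sum>j=1..n-3. - 1 / (x - q j))
                 + poly D_inf x)"
    proof (rule exI[of _ "\<lambda>j. poly A (q j)"], rule exI[of _ Cp], rule exI[of _ Dp],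
        rule exI[of _ C_inf], rule exI[of _ D_infp], rule exI[of _ Ct], intro conjI ballI allI impI)
    qed (use c d in auto)
  qed
qed

end
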